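(* Let $(\boldsymbol{X},\boldsymbol{T})$ and $(\boldsymbol{Y},\boldsymbol{R})$ be nonautonomous dynamical systems, $Z\subset X_0$ and $W\subset Y_0$. Then for all equicontinuous $\boldsymbol{f}\in\boldsymbol{C}(\boldsymbol{X},\mathbb{R})$ and equicontinuous $\boldsymbol{g}\in\boldsymbol{C}(\boldsymbol{Y},\mathbb{R})$, $$P^{\mathrm{B}}(\boldsymbol{T},\boldsymbol{f},Z)+P^{\mathrm{B}}(\boldsymbol{R},\boldsymbol{g},W)\le P^{\mathrm{B}}(\boldsymbol{T}\times\boldsymbol{R},\boldsymbol{f}\dotplus\boldsymbol{g},Z\times W)\le P^{\mathrm{B}}(\boldsymbol{T},\boldsymbol{f},Z)+P^{\mathrm{P}}(\boldsymbol{R},\boldsymbol{g},W),$$ where it is assumed that the sums of pressures appearing are well defined, i.e. not of the form $\infty-\infty$.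
   Context: A nonautonomous dynamical system (NDS) $(\boldsymbol{X},\boldsymbol{T})$ consists of a sequence $\boldsymbol{X}=\{X_k\}_{k=0}^\infty$ of compact metric spaces $(X_k,d_k)$ and a sequence $\boldsymbol{T}=\{T_k\}_{k=0}^\infty$ of continuous maps $T_k:X_k\to X_{k+1}$. Write $\boldsymbol{T}^0=\mathrm{id}_{X_0}$ and $\boldsymbol{T}^j=T_{j-1}\circ\cdots\circ T_0:X_0\to X_j$. For $n\ge 1$ the $n$-th Bowen metric on $X_0$ is $d_n^{\boldsymbol{T}}(x,y)=\max_{0\le j\le n-1}d_j(\boldsymbol{T}^jx,\boldsymbol{T}^jy)$; $B_n^{\boldsymbol{T}}(x,\varepsilon)$ and $\overline{B}_n^{\boldsymbol{T}}(x,\varepsilon)$ are the open ($<\varepsilon$) and closed ($\le\varepsilon$) balls of this metric. $\boldsymbol{C}(\boldsymbol{X},\mathbb{R})=\prod_{k\ge 0}C(X_k,\mathbb{R})$ is the set of sequences $\boldsymbol{f}=\{f_k\}_{k=0}^\infty$ of continuous functions $f_k:X_k\to\mathbb{R}$, and $S_n^{\boldsymbol{T}}\boldsymbol{f}=\sum_{j=0}^{n-1}f_j\circ\boldsymbol{T}^j$. $\boldsymbol{f}$ is equicontinuous if for every $\varepsilon>0$ there is $\delta>0$ such that for all $k\ge0$ and $x,y\in X_k$ with $d_k(x,y)<\delta$ we have $|f_k(x)-f_k(y)|<\varepsilon$. Products. $\boldsymbol{X}\times\boldsymbol{Y}=\{X_k\times Y_k\}_{k\ge0}$ with metrics $\max\{d_{X_k}(x_1,x_2),d_{Y_k}(y_1,y_2)\}$;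 $\boldsymbol{T}\times\boldsymbol{R}=\{T_k\times R_k\}_{k\ge0}$ with $(T_k\times R_k)(x,y)=(T_kx,R_ky)$; $\boldsymbol{f}\dotplus\boldsymbol{g}=\{f_k\dotplus g_k\}_{k\ge0}$ with $(f_k\dotplus g_k)(x,y)=f_k(x)+g_k(y)$. Bowen pressure. For $s\in\mathbb{R}$, $N>0$, $\varepsilon>0$ let $\mathscr{R}^s_{N,\varepsilon}(\boldsymbol{T},\boldsymbol{f},Z)=\inf\sum_i\exp(-n_is+S_{n_i}^{\boldsymbol{T}}\boldsymbol{f}(x_i))$ over all countable families $\{B_{n_i}^{\boldsymbol{T}}(x_i,\varepsilon)\}_i$ with $n_i\ge N$, $x_i\in X_0$, covering $Z$. Put $\mathscr{R}^s_\varepsilon=\lim_{N\to\infty}\mathscr{R}^s_{N,\varepsilon}$, $P^{\mathrm{B}}(\boldsymbol{T},\boldsymbol{f},Z,\varepsilon)=\inf\{s:\mathscr{R}^s_\varepsilon(\boldsymbol{T},\boldsymbol{f},Z)=0\}=\sup\{s:\mathscr{R}^s_\varepsilon(\boldsymbol{T},\boldsymbol{f},Z)=+\infty\}$, and $P^{\mathrm{B}}(\boldsymbol{T},\boldsymbol{f},Z)=\lim_{\varepsilon\to0}P^{\mathrm{B}}(\boldsymbol{T},\boldsymbol{f},Z,\varepsilon)$. Packing pressure. Let $\mathscr{P}^s_{N,\varepsilon}(\boldsymbol{T},\boldsymbol{f},Z)=\sup\sum_i\exp(-n_is+S_{n_i}^{\boldsymbol{T}}\boldsymbol{f}(x_i))$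 over all (at most) countable pairwise disjoint families $\{\overline{B}_{n_i}^{\boldsymbol{T}}(x_i,\varepsilon)\}_i$ with $x_i\in Z$, $n_i\ge N$. Put $\mathscr{P}^s_{\infty,\varepsilon}=\lim_{N\to\infty}\mathscr{P}^s_{N,\varepsilon}$, $\mathscr{P}^s_\varepsilon(\boldsymbol{T},\boldsymbol{f},Z)=\inf\{\sum_{i=1}^\infty\mathscr{P}^s_{\infty,\varepsilon}(\boldsymbol{T},\boldsymbol{f},Z_i):\bigcup_iZ_i\supset Z\}$, $P^{\mathrm{P}}(\boldsymbol{T},\boldsymbol{f},Z,\varepsilon)=\inf\{s:\mathscr{P}^s_\varepsilon(\boldsymbol{T},\boldsymbol{f},Z)=0\}=\sup\{s:\mathscr{P}^s_\varepsilon(\boldsymbol{T},\boldsymbol{f},Z)=+\infty\}$, and $P^{\mathrm{P}}(\boldsymbol{T},\boldsymbol{f},Z)=\lim_{\varepsilon\to0}P^{\mathrm{P}}(\boldsymbol{T},\boldsymbol{f},Z,\varepsilon)$. All pressures take values in $\mathbb{R}\cup\{\pm\infty\}$. *)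

theory Defs
  imports "HOL-Analysis.Analysis"
begin

(* The spaces X_k of a system are metric spaces with explicit carriers inside one common
   type 'a.  Maps and functions are total on 'a, but every notion below only looks at them
   on the carriers (up to junk values that are never inspected). *)

definition NDS :: "(nat \<Rightarrow> 'a metric) \<Rightarrow> (nat \<Rightarrow> 'a \<Rightarrow> 'a) \<Rightarrow> bool" where
  "NDS X T \<longleftrightarrow>
     (\<forall>k. compact_space (mtopology_of (X k))) \<and>
     (\<forall>k. continuous_map (mtopology_of (X k)) (mtopology_of (X (Suc k))) (T k))"

primrec iter :: "(nat \<Rightarrow> 'a \<Rightarrow> 'a) \<Rightarrow> nat \<Rightarrow> 'a \<Rightarrow> 'a" where
  "iter T 0 = id"
| "iter T (Suc j) = T j \<circ> iter T j"

(* Meaningful for n \<ge> 1 only: for n = 0 it is the unspecified maximum of the empty set. *)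
definition bowen_dist ::
  "(nat \<Rightarrow> 'a metric) \<Rightarrow> (nat \<Rightarrow> 'a \<Rightarrow> 'a) \<Rightarrow> nat \<Rightarrow> 'a \<Rightarrow> 'a \<Rightarrow> real" where
  "bowen_dist X T n x y = (MAX j\<in>{..<n}. mdist (X j) (iter T j x) (iter T j y))"

definition bowen_ball ::
  "(nat \<Rightarrow> 'a metric) \<Rightarrow> (nat \<Rightarrow> 'a \<Rightarrow> 'a) \<Rightarrow> nat \<Rightarrow> 'a \<Rightarrow> real \<Rightarrow> 'a set" where
  "bowen_ball X T n x \<epsilon> = {y \<in> mspace (X 0). bowen_dist X T n x y < \<epsilon>}"

definition bowen_cball ::
  "(nat \<Rightarrow> 'a metric) \<Rightarrow> (nat \<Rightarrow> 'a \<Rightarrow> 'a) \<Rightarrow> nat \<Rightarrow> 'a \<Rightarrow> real \<Rightarrow> 'a set" where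
  "bowen_cball X T n x \<epsilon> = {y \<in> mspace (X 0). bowen_dist X T n x y \<le> \<epsilon>}"

definition cont_fun_seq :: "(nat \<Rightarrow> 'a metric) \<Rightarrow> (nat \<Rightarrow> 'a \<Rightarrow> real) \<Rightarrow> bool" where
  "cont_fun_seq X f \<longleftrightarrow> (\<forall>k. continuous_map (mtopology_of (X k)) euclideanreal (f k))"

definition equicont_seq :: "(nat \<Rightarrow> 'a metric) \<Rightarrow> (nat \<Rightarrow> 'a \<Rightarrow> real) \<Rightarrow> bool" where
  "equicont_seq X f \<longleftrightarrow>
     (\<forall>\<epsilon>>0. \<exists>\<delta>>0. \<forall>k. \<forall>x\<in>mspace (X k). \<forall>y\<in>mspace (X k).
        mdist (X k) x y < \<delta> \<longrightarrow> \<bar>f k x - f k y\<bar> < \<epsilon>)"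

definition birkhoff_sum ::
  "(nat \<Rightarrow> 'a \<Rightarrow> 'a) \<Rightarrow> (nat \<Rightarrow> 'a \<Rightarrow> real) \<Rightarrow> nat \<Rightarrow> 'a \<Rightarrow> real" where
  "birkhoff_sum T f n x = (\<Sum>j<n. f j (iter T j x))"

(* The library's prod_metric carries the Euclidean combination of the two distances,
   so the maximum metric is built here. *)
definition max_prod_metric :: "'a metric \<Rightarrow> 'b metric \<Rightarrow> ('a \<times> 'b) metric" where
  "max_prod_metric m1 m2 =
     metric (mspace m1 \<times> mspace m2,
             \<lambda>(x1, y1) (x2, y2). max (mdist m1 x1 x2) (mdist m2 y1 y2))"

lemma Metric_space_max_prod:
  "Metric_space (mspace m1 \<times> mspace m2)
     (\<lambda>(x1, y1) (x2, y2). max (mdist m1 x1 x2) (mdist m2 y1 y2))"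
proof
  fix p q :: "'a \<times> 'b"
  obtain x y x' y' where [simp]: "p = (x, y)" "q = (x', y')"
    by (metis surj_pair)
  show "0 \<le> (\<lambda>(x1, y1) (x2, y2). max (mdist m1 x1 x2) (mdist m2 y1 y2)) p q"
    by (simp add: le_max_iff_disj)
  show "(\<lambda>(x1, y1) (x2, y2). max (mdist m1 x1 x2) (mdist m2 y1 y2)) p q =
        (\<lambda>(x1, y1) (x2, y2). max (mdist m1 x1 x2) (mdist m2 y1 y2)) q p"
    by (simp add: mdist_commute)
  assume "p \<in> mspace m1 \<times> mspace m2" "q \<in> mspace m1 \<times> mspace m2"
  then have *: "x \<in> mspace m1" "x' \<in> mspace m1" "y \<in> mspace m2" "y' \<in> mspace m2"
    by auto
  have "max (mdist m1 x x') (mdist m2 y y') = 0 \<longleftrightarrow> mdist m1 x x' = 0 \<and> mdist m2 y y' = 0"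
    using mdist_nonneg[of m1 x x'] mdist_nonneg[of m2 y y'] by linarith
  then show "((\<lambda>(x1, y1) (x2, y2). max (mdist m1 x1 x2) (mdist m2 y1 y2)) p q = 0) = (p = q)"
    using * by simp
next
  fix p q r :: "'a \<times> 'b"
  assume "p \<in> mspace m1 \<times> mspace m2" "q \<in> mspace m1 \<times> mspace m2" "r \<in> mspace m1 \<times> mspace m2"
  then show "(\<lambda>(x1, y1) (x2, y2). max (mdist m1 x1 x2) (mdist m2 y1 y2)) p r \<le>
        (\<lambda>(x1, y1) (x2, y2). max (mdist m1 x1 x2) (mdist m2 y1 y2)) p q +
        (\<lambda>(x1, y1) (x2, y2). max (mdist m1 x1 x2) (mdist m2 y1 y2)) q r"
    using mdist_triangle[of "fst p" m1 "fst q" "fst r"] mdist_triangle[of "snd p" m2 "snd q" "snd r"]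
    by (auto split: prod.splits)
qed

lemma mspace_max_prod_metric [simp]:
  "mspace (max_prod_metric m1 m2) = mspace m1 \<times> mspace m2"
  by (simp add: max_prod_metric_def Metric_space.mspace_metric[OF Metric_space_max_prod])

lemma mdist_max_prod_metric [simp]:
  "mdist (max_prod_metric m1 m2) (x1, y1) (x2, y2) = max (mdist m1 x1 x2) (mdist m2 y1 y2)"
  by (simp add: max_prod_metric_def Metric_space.mdist_metric[OF Metric_space_max_prod])

definition prod_spaces ::
  "(nat \<Rightarrow> 'a metric) \<Rightarrow> (nat \<Rightarrow> 'b metric) \<Rightarrow> nat \<Rightarrow> ('a \<times> 'b) metric" where
  "prod_spaces X Y k = max_prod_metric (X k) (Y k)"

definition prod_maps ::
  "(nat \<Rightarrow> 'a \<Rightarrow> 'a) \<Rightarrow> (nat \<Rightarrow> 'b \<Rightarrow> 'b) \<Rightarrow> nat \<Rightarrow> 'a \<times> 'b \<Rightarrow> 'a \<times> 'b" where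
  "prod_maps T R k = map_prod (T k) (R k)"

definition dotplus ::
  "(nat \<Rightarrow> 'a \<Rightarrow> real) \<Rightarrow> (nat \<Rightarrow> 'b \<Rightarrow> real) \<Rightarrow> nat \<Rightarrow> 'a \<times> 'b \<Rightarrow> real" where
  "dotplus f g k = (\<lambda>(x, y). f k x + g k y)"

definition weight ::
  "(nat \<Rightarrow> 'a \<Rightarrow> 'a) \<Rightarrow> (nat \<Rightarrow> 'a \<Rightarrow> real) \<Rightarrow> real \<Rightarrow> nat \<Rightarrow> 'a \<Rightarrow> ennreal" where
  "weight T f s n x = ennreal (exp (- real n * s + birkhoff_sum T f n x))"

(* A countable family is indexed by an arbitrary I :: nat set, so finite families and the
   empty family are included.  Sums and infima of weights live in [0, \<infinity>]. *)
definition bowen_pre ::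
  "(nat \<Rightarrow> 'a metric) \<Rightarrow> (nat \<Rightarrow> 'a \<Rightarrow> 'a) \<Rightarrow> (nat \<Rightarrow> 'a \<Rightarrow> real) \<Rightarrow> 'a set \<Rightarrow> real \<Rightarrow> nat \<Rightarrow> real \<Rightarrow> ennreal"
  where
  "bowen_pre X T f Z s N \<epsilon> =
     Inf {\<Sum>\<^sub>\<infinity>i\<in>I. weight T f s (n i) (x i) | (I :: nat set) n x.
            (\<forall>i\<in>I. N \<le> n i \<and> x i \<in> mspace (X 0)) \<and>
            Z \<subseteq> (\<Union>i\<in>I. bowen_ball X T (n i) (x i) \<epsilon>)}"

(* The value at N = 0 is irrelevant for the limit. *)
definition bowen_measure ::
  "(nat \<Rightarrow> 'a metric) \<Rightarrow> (nat \<Rightarrow> 'a \<Rightarrow> 'a) \<Rightarrow> (nat \<Rightarrow> 'a \<Rightarrow> real) \<Rightarrow> 'a set \<Rightarrow> real \<Rightarrow> real \<Rightarrow> ennreal"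
  where
  "bowen_measure X T f Z s \<epsilon> = lim (\<lambda>N. bowen_pre X T f Z s N \<epsilon>)"

(* The infimum of the empty set of exponents is \<infinity>, and that of all of them is -\<infinity>. *)
definition bowen_pressure_at ::
  "(nat \<Rightarrow> 'a metric) \<Rightarrow> (nat \<Rightarrow> 'a \<Rightarrow> 'a) \<Rightarrow> (nat \<Rightarrow> 'a \<Rightarrow> real) \<Rightarrow> 'a set \<Rightarrow> real \<Rightarrow> ereal"
  where
  "bowen_pressure_at X T f Z \<epsilon> = Inf {ereal s | s. bowen_measure X T f Z s \<epsilon> = 0}"

definition bowen_pressure ::
  "(nat \<Rightarrow> 'a metric) \<Rightarrow> (nat \<Rightarrow> 'a \<Rightarrow> 'a) \<Rightarrow> (nat \<Rightarrow> 'a \<Rightarrow> real) \<Rightarrow> 'a set \<Rightarrow> ereal"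
  where
  "bowen_pressure X T f Z = Lim (at_right 0) (\<lambda>\<epsilon>. bowen_pressure_at X T f Z \<epsilon>)"

definition packing_pre ::
  "(nat \<Rightarrow> 'a metric) \<Rightarrow> (nat \<Rightarrow> 'a \<Rightarrow> 'a) \<Rightarrow> (nat \<Rightarrow> 'a \<Rightarrow> real) \<Rightarrow> 'a set \<Rightarrow> real \<Rightarrow> nat \<Rightarrow> real \<Rightarrow> ennreal"
  where
  "packing_pre X T f Z s N \<epsilon> =
     Sup {\<Sum>\<^sub>\<infinity>i\<in>I. weight T f s (n i) (x i) | (I :: nat set) n x.
            (\<forall>i\<in>I. N \<le> n i \<and> x i \<in> Z) \<and>
            disjoint_family_on (\<lambda>i. bowen_cball X T (n i) (x i) \<epsilon>) I}"

definition packing_premeasure ::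
  "(nat \<Rightarrow> 'a metric) \<Rightarrow> (nat \<Rightarrow> 'a \<Rightarrow> 'a) \<Rightarrow> (nat \<Rightarrow> 'a \<Rightarrow> real) \<Rightarrow> 'a set \<Rightarrow> real \<Rightarrow> real \<Rightarrow> ennreal"
  where
  "packing_premeasure X T f Z s \<epsilon> = lim (\<lambda>N. packing_pre X T f Z s N \<epsilon>)"

definition packing_measure ::
  "(nat \<Rightarrow> 'a metric) \<Rightarrow> (nat \<Rightarrow> 'a \<Rightarrow> 'a) \<Rightarrow> (nat \<Rightarrow> 'a \<Rightarrow> real) \<Rightarrow> 'a set \<Rightarrow> real \<Rightarrow> real \<Rightarrow> ennreal"
  where
  "packing_measure X T f Z s \<epsilon> =
     Inf {\<Sum>i. packing_premeasure X T f (Zs i) s \<epsilon> | Zs :: nat \<Rightarrow> 'a set.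
            (\<forall>i. Zs i \<subseteq> mspace (X 0)) \<and> Z \<subseteq> (\<Union>i. Zs i)}"

definition packing_pressure_at ::
  "(nat \<Rightarrow> 'a metric) \<Rightarrow> (nat \<Rightarrow> 'a \<Rightarrow> 'a) \<Rightarrow> (nat \<Rightarrow> 'a \<Rightarrow> real) \<Rightarrow> 'a set \<Rightarrow> real \<Rightarrow> ereal"
  where
  "packing_pressure_at X T f Z \<epsilon> = Inf {ereal s | s. packing_measure X T f Z s \<epsilon> = 0}"

definition packing_pressure ::
  "(nat \<Rightarrow> 'a metric) \<Rightarrow> (nat \<Rightarrow> 'a \<Rightarrow> 'a) \<Rightarrow> (nat \<Rightarrow> 'a \<Rightarrow> real) \<Rightarrow> 'a set \<Rightarrow> ereal"
  where
  "packing_pressure X T f Z = Lim (at_right 0) (\<lambda>\<epsilon>. packing_pressure_at X T f Z \<epsilon>)"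

(* In type ereal the undefined sum \<infinity> - \<infinity> has a conventional value; this excludes it. *)
definition sum_well_defined :: "ereal \<Rightarrow> ereal \<Rightarrow> bool" where
  "sum_well_defined a b \<longleftrightarrow> \<not> (a = \<infinity> \<and> b = -\<infinity>) \<and> \<not> (a = -\<infinity> \<and> b = \<infinity>)"

(* Every limit taken above exists, so lim and Lim have their intended values. *)

lemma bowen_pre_mono: "M \<le> N \<Longrightarrow> bowen_pre X T f Z s M \<epsilon> \<le> bowen_pre X T f Z s N \<epsilon>"
  unfolding bowen_pre_def by (rule Inf_superset_mono) (blast intro: order_trans)

lemma bowen_measure_limit:
  "(\<lambda>N. bowen_pre X T f Z s N \<epsilon>) \<longlonglongrightarrow> bowen_measure X T f Z s \<epsilon>"
  unfolding bowen_measure_def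
  by (metis LIMSEQ_SUP bowen_pre_mono limI incseq_def)

lemma packing_pre_antimono:
  "M \<le> N \<Longrightarrow> packing_pre X T f Z s N \<epsilon> \<le> packing_pre X T f Z s M \<epsilon>"
  unfolding packing_pre_def by (rule Sup_subset_mono) (blast intro: order_trans)

lemma packing_premeasure_limit:
  "(\<lambda>N. packing_pre X T f Z s N \<epsilon>) \<longlonglongrightarrow> packing_premeasure X T f Z s \<epsilon>"
  unfolding packing_premeasure_def
  by (metis LIMSEQ_INF packing_pre_antimono limI decseq_def)

lemma bowen_ball_mono: "\<epsilon> \<le> \<epsilon>' \<Longrightarrow> bowen_ball X T n x \<epsilon> \<subseteq> bowen_ball X T n x \<epsilon>'"
  by (auto simp: bowen_ball_def)

lemma bowen_cball_mono: "\<epsilon> \<le> \<epsilon>' \<Longrightarrow> bowen_cball X T n x \<epsilon> \<subseteq> bowen_cball X T n x \<epsilon>'"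
  by (auto simp: bowen_cball_def)

lemma bowen_pre_antimono_radius:
  assumes "\<epsilon> \<le> \<epsilon>'"
  shows "bowen_pre X T f Z s N \<epsilon>' \<le> bowen_pre X T f Z s N \<epsilon>"
proof -
  have "Z \<subseteq> (\<Union>i\<in>I. bowen_ball X T (n i) (x i) \<epsilon>')"
    if "Z \<subseteq> (\<Union>i\<in>I. bowen_ball X T (n i) (x i) \<epsilon>)" for I and n :: "nat \<Rightarrow> nat" and x
    using that bowen_ball_mono[OF assms, of X T] by blast
  then show ?thesis
    unfolding bowen_pre_def by (intro Inf_superset_mono) blast
qed

lemma packing_pre_antimono_radius:
  assumes "\<epsilon> \<le> \<epsilon>'"
  shows "packing_pre X T f Z s N \<epsilon>' \<le> packing_pre X T f Z s N \<epsilon>"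
proof -
  have "disjoint_family_on (\<lambda>i. bowen_cball X T (n i) (x i) \<epsilon>) I"
    if "disjoint_family_on (\<lambda>i. bowen_cball X T (n i) (x i) \<epsilon>') I"
    for I and n :: "nat \<Rightarrow> nat" and x
    using that bowen_cball_mono[OF assms, of X T] unfolding disjoint_family_on_def by blast
  then show ?thesis
    unfolding packing_pre_def by (intro Sup_subset_mono) blast
qed

lemma packing_premeasure_antimono_radius:
  "\<epsilon> \<le> \<epsilon>' \<Longrightarrow> packing_premeasure X T f Z s \<epsilon>' \<le> packing_premeasure X T f Z s \<epsilon>"
  by (rule LIMSEQ_le[OF packing_premeasure_limit packing_premeasure_limit])
     (auto intro: packing_pre_antimono_radius)

lemma packing_measure_antimono_radius:
  assumes "\<epsilon> \<le> \<epsilon>'"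
  shows "packing_measure X T f Z s \<epsilon>' \<le> packing_measure X T f Z s \<epsilon>"
proof -
  have "(\<Sum>i. packing_premeasure X T f (Zs i) s \<epsilon>') \<le> (\<Sum>i. packing_premeasure X T f (Zs i) s \<epsilon>)"
    for Zs :: "nat \<Rightarrow> 'a set"
    by (intro suminf_le packing_premeasure_antimono_radius assms) auto
  then show ?thesis
    unfolding packing_measure_def by (intro Inf_mono) blast
qed

lemma bowen_pressure_at_antimono:
  assumes "\<epsilon> \<le> \<epsilon>'"
  shows "bowen_pressure_at X T f Z \<epsilon>' \<le> bowen_pressure_at X T f Z \<epsilon>"
proof -
  have "bowen_measure X T f Z s \<epsilon>' \<le> bowen_measure X T f Z s \<epsilon>" for s
    by (rule LIMSEQ_le[OF bowen_measure_limit bowen_measure_limit])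
       (auto intro: bowen_pre_antimono_radius assms)
  then have "bowen_measure X T f Z s \<epsilon>' = 0" if "bowen_measure X T f Z s \<epsilon> = 0" for s
    using that by (metis le_zero_eq)
  then show ?thesis
    unfolding bowen_pressure_at_def by (intro Inf_superset_mono) blast
qed

lemma packing_pressure_at_antimono:
  assumes "\<epsilon> \<le> \<epsilon>'"
  shows "packing_pressure_at X T f Z \<epsilon>' \<le> packing_pressure_at X T f Z \<epsilon>"
proof -
  have "packing_measure X T f Z s \<epsilon>' = 0" if "packing_measure X T f Z s \<epsilon> = 0" for s
    using that packing_measure_antimono_radius[OF assms, of X T f Z s] by simp
  then show ?thesis
    unfolding packing_pressure_at_def by (intro Inf_superset_mono) blast
qed

lemma tendsto_at_right_0_antimono:
  fixes h :: "real \<Rightarrow> ereal"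
  assumes "\<And>a b. a \<le> b \<Longrightarrow> h b \<le> h a"
  shows "(h \<longlongrightarrow> (SUP e\<in>{0<..}. h e)) (at_right 0)"
proof (rule order_tendstoI)
  fix a assume "a < (SUP e\<in>{0<..}. h e)"
  then obtain d where d: "d > 0" "a < h d"
    by (auto simp: less_SUP_iff)
  have "\<forall>\<^sub>F e in at_right 0. e \<in> {0<..<d}"
    using d(1) by (rule eventually_at_right_real)
  then show "\<forall>\<^sub>F e in at_right 0. a < h e"
    by eventually_elim (use d(2) assms in \<open>force intro: less_le_trans\<close>)
next
  fix a assume a: "(SUP e\<in>{0<..}. h e) < a"
  have "\<forall>\<^sub>F e in at_right 0. e \<in> {0<..<(1::real)}"
    by (rule eventually_at_right_real) simp
  then show "\<forall>\<^sub>F e in at_right 0. h e < a"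
    by eventually_elim (use a in \<open>auto intro: le_less_trans[OF SUP_upper]\<close>)
qed

lemma bowen_pressure_limit:
  "((\<lambda>\<epsilon>. bowen_pressure_at X T f Z \<epsilon>) \<longlongrightarrow> bowen_pressure X T f Z) (at_right 0)"
proof -
  have "((\<lambda>\<epsilon>. bowen_pressure_at X T f Z \<epsilon>) \<longlongrightarrow> (SUP \<epsilon>\<in>{0<..}. bowen_pressure_at X T f Z \<epsilon>)) (at_right 0)"
    by (intro tendsto_at_right_0_antimono bowen_pressure_at_antimono)
  then show ?thesis
    unfolding bowen_pressure_def by (simp add: tendsto_Lim)
qed

lemma packing_pressure_limit:
  "((\<lambda>\<epsilon>. packing_pressure_at X T f Z \<epsilon>) \<longlongrightarrow> packing_pressure X T f Z) (at_right 0)"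
proof -
  have "((\<lambda>\<epsilon>. packing_pressure_at X T f Z \<epsilon>) \<longlongrightarrow> (SUP \<epsilon>\<in>{0<..}. packing_pressure_at X T f Z \<epsilon>)) (at_right 0)"
    by (intro tendsto_at_right_0_antimono packing_pressure_at_antimono)
  then show ?thesis
    unfolding packing_pressure_def by (simp add: tendsto_Lim)
qed

end

(* Upper bound: if the packing measure of W vanishes at t, then W splits into countably many pieces
   V whose packing sums are bounded.  Given a cover of Z by Bowen balls, take for each of its orders n
   a maximal disjoint family of closed balls of order n centred in V; tripling the radii covers V,
   so the product balls cover Z \<times> V with small total weight.

   Lower bound: a cover of Z \<times> W by balls B \<times> C, restricted to those with z \<in> B, covers W for
   every z \<in> Z.  Normalising the weights of the C therefore yields a weighted (fractional) cover of Z
   by the B.  A weighted cover is turned into an ordinary one of twice the radius, at the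
   cost of an arbitrarily small change of the exponent: on the points that receive weight at least
   exp (- n \<delta>) from the balls of order n take a maximal 2 \<epsilon>-separated set.  Each ball of
   the weighted cover contains at most one of its points, which avoids any Frostman or Vitali
   argument, and compactness. *)
theory Submission
  imports Defs
begin

subsection \<open>Sums over countable families\<close>

text \<open>An enumeration of \<open>A\<close> turns both sides into the same series. The
  pre-measures are defined by \<open>infsum\<close>; as integrals over counting measure, their sums
  become accessible to Tonelli's theorem, monotonicity and \<open>nn_integral_cmult\<close>.\<close>

lemma infsum_eq_nn_integral_count_space:
  fixes h :: "'i \<Rightarrow> ennreal"
  assumes "countable A"
  shows "infsum h A = (\<integral>\<^sup>+i. h i \<partial>count_space A)"
proof (cases "finite A")
  case True
  then show ?thesis
    by (simp add: nn_integral_count_space_finite)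
next
  case False
  note b = bij_betw_from_nat_into[OF assms False]
  have "infsum h A = infsum (\<lambda>k. h (from_nat_into A k)) UNIV"
    using infsum_reindex_bij_betw[OF b, of h] by simp
  also have "\<dots> = (\<Sum>k. h (from_nat_into A k))"
    by (intro sums_unique has_sum_imp_sums has_sum_infsum nonneg_summable_on_complete) simp
  also have "\<dots> = (\<integral>\<^sup>+i. h i \<partial>count_space A)"
    using nn_integral_bij_count_space[OF b, of h] by (simp add: nn_integral_count_space_nat)
  finally show ?thesis .
qed

text \<open>Extension by zero to the full product type reduces a dependent index set to Tonelli's
  theorem. Covers that are merged from a family of covers are indexed by such sets.\<close>

lemma nn_integral_count_space_Sigma:
  fixes h :: "'i \<times> 'j \<Rightarrow> ennreal"
  shows "(\<integral>\<^sup>+p. h p \<partial>count_space (Sigma A B)) =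
    (\<integral>\<^sup>+i. (\<integral>\<^sup>+j. h (i, j) \<partial>count_space (B i)) \<partial>count_space A)"
proof -
  have "(\<integral>\<^sup>+p. h p \<partial>count_space (Sigma A B)) =
      (\<integral>\<^sup>+p. h p * indicator (Sigma A B) p \<partial>count_space UNIV)"
    by (simp add: nn_integral_restrict_space[symmetric] restrict_count_space)
  also have "\<dots> = (\<integral>\<^sup>+i. (\<integral>\<^sup>+j. h (i, j) * indicator (Sigma A B) (i, j) \<partial>count_space UNIV) \<partial>count_space UNIV)"
    using nn_integral_fst_count_space[of "\<lambda>p. h p * indicator (Sigma A B) p"] by simp
  also have "\<dots> = (\<integral>\<^sup>+i. (\<integral>\<^sup>+j. h (i, j) * indicator (B i) j \<partial>count_space UNIV) * indicator A i \<partial>count_space UNIV)"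
    by (intro nn_integral_cong) (auto simp: indicator_def)
  also have "\<dots> = (\<integral>\<^sup>+i. (\<integral>\<^sup>+j. h (i, j) \<partial>count_space (B i)) \<partial>count_space A)"
    by (simp add: nn_integral_restrict_space[symmetric] restrict_count_space)
  finally show ?thesis .
qed

text \<open>The map sending \<open>i\<close> to \<open>(n i, i)\<close> is a bijection onto the
  disjoint union of the fibres of \<open>n\<close>. It serves to sort a cover by the orders of its
  balls.\<close>

lemma nn_integral_count_space_fibres:
  fixes h :: "'i \<Rightarrow> ennreal"
  assumes "\<And>i. i \<in> I \<Longrightarrow> n i \<in> M"
  shows "(\<integral>\<^sup>+i. h i \<partial>count_space I) =
    (\<integral>\<^sup>+m. (\<integral>\<^sup>+i. h i \<partial>count_space {i \<in> I. n i = m}) \<partial>count_space M)"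
proof -
  have "bij_betw (\<lambda>i. (n i, i)) I (Sigma M (\<lambda>m. {i \<in> I. n i = m}))"
    using assms by (auto simp: bij_betw_def inj_on_def)
  from nn_integral_bij_count_space[OF this, of "\<lambda>p. h (snd p)"] show ?thesis
    by (simp add: nn_integral_count_space_Sigma)
qed

text \<open>Zorn's lemma for sets of pairwise related elements: an element related to all of
  \<open>M\<close> could be added, symmetry supplying both directions. It is applied to disjointness
  of closed balls and to separation of points.\<close>

lemma maximal_pairwiseE:
  assumes "symp r"
  obtains M where "M \<subseteq> A" "pairwise r M" "\<And>a. a \<in> A - M \<Longrightarrow> \<exists>m\<in>M. \<not> r a m"
proof -
  let ?\<A> = "{M. M \<subseteq> A \<and> pairwise r M}"
  have "\<exists>M\<in>?\<A>. \<forall>M'\<in>?\<A>. M \<subseteq> M' \<longrightarrow> M' = M"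
  proof (rule subset_Zorn')
    fix C assume C: "subset.chain ?\<A> C"
    then have "pairwise r (\<Union>C)"
      by (intro pairwise_chain_Union) (use C in \<open>unfold subset.chain_def chain_subset_def, blast+\<close>)
    with C show "\<Union>C \<in> ?\<A>"
      by (auto simp: subset.chain_def)
  qed
  then obtain M where "M \<in> ?\<A>" and "\<forall>M'\<in>?\<A>. M \<subseteq> M' \<longrightarrow> M' = M"
    by (rule bexE)
  then have M: "M \<subseteq> A" "pairwise r M"
    and max: "\<And>M'. M' \<subseteq> A \<Longrightarrow> pairwise r M' \<Longrightarrow> M \<subseteq> M' \<Longrightarrow> M' = M"
    by simp_all
  have "\<exists>m\<in>M. \<not> r a m" if "a \<in> A - M" for a
  proof (rule ccontr)
    assume "\<not> (\<exists>m\<in>M. \<not> r a m)"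
    then have "pairwise r (insert a M)"
      using M(2) assms by (auto simp: pairwise_insert dest: sympD)
    then show False
      using max[of "insert a M"] M(1) that by blast
  qed
  with M show ?thesis
    using that by blast
qed

text \<open>The tail is a geometric series of ratio \<open>exp (- \<delta>)\<close>. It bounds the
  mass that a point can receive while staying below the threshold
  \<open>exp (- real m * \<delta>)\<close> at every order \<open>m\<close>; a point of a weighted
  cover receives at least 1.\<close>

lemma exp_tail_less_1E:
  fixes \<delta> :: real
  assumes "0 < \<delta>"
  obtains K where "\<And>N. K \<le> N \<Longrightarrow> (\<integral>\<^sup>+m. ennreal (exp (- real m * \<delta>)) \<partial>count_space {N..}) < 1"
proof -
  define q where "q = exp (- \<delta>)"
  have q: "0 < q" "q < 1"
    using assms by (simp_all add: q_def)
  have pow: "exp (- real m * \<delta>) = q ^ m" for m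
    by (simp add: q_def flip: exp_of_nat_mult)
  have tail: "(\<integral>\<^sup>+m. ennreal (exp (- real m * \<delta>)) \<partial>count_space {N..}) = ennreal (q ^ N / (1 - q))" for N
  proof -
    have b: "bij_betw (\<lambda>k. k + N) UNIV {N..}"
      by (rule bij_betw_byWitness[of _ "\<lambda>m. m - N"]) auto
    have "(\<integral>\<^sup>+m. ennreal (exp (- real m * \<delta>)) \<partial>count_space {N..}) = (\<Sum>k. ennreal (q ^ (k + N)))"
      using nn_integral_bij_count_space[OF b, of "\<lambda>m. ennreal (exp (- real m * \<delta>))"]
      by (simp only: pow nn_integral_count_space_nat)
    also have "(\<lambda>k. q ^ N * q ^ k) sums (q ^ N * (1 / (1 - q)))"
      using q by (intro sums_mult geometric_sums) simp
    then have "(\<Sum>k. ennreal (q ^ (k + N))) = ennreal (q ^ N / (1 - q))"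
      using q by (intro sums_unique[symmetric]) (auto simp: sums_ennreal power_add mult.commute)
    finally show ?thesis .
  qed
  have "(\<lambda>N. q ^ N / (1 - q)) \<longlonglongrightarrow> 0 / (1 - q)"
    using q by (intro tendsto_intros LIMSEQ_power_zero) auto
  then have "\<forall>\<^sub>F N in sequentially. q ^ N / (1 - q) < 1"
    by (intro order_tendstoD(2)) auto
  then obtain K where "\<And>N. K \<le> N \<Longrightarrow> q ^ N / (1 - q) < 1"
    by (auto simp: eventually_sequentially)
  then show ?thesis
    using q by (intro that[of K]) (simp only: tail ennreal_less_one_iff)
qed

section \<open>Real exponents separating a sum of extended reals from a bound\<close>

lemma ereal_add_less_realE:
  fixes A B u :: ereal
  assumes "A < \<infinity>" "B < \<infinity>" "A + B < u"
  obtains s t where "A < ereal s" "B < ereal t" "ereal s + ereal t \<le> u"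
proof (cases u)
  case (real r)
  show ?thesis
  proof (cases A; cases B)
    fix x y assume "A = ereal x" "B = ereal y"
    then show ?thesis
      \<comment> \<open>The slack \<open>r - x - y\<close> is shared equally, so the two exponents
        add up to exactly \<open>r\<close>.\<close>
      using assms real that[of "x + (r - x - y) / 2" "y + (r - x - y) / 2"] by (simp add: field_simps)
  next
    fix x assume "A = ereal x" "B = - \<infinity>"
    then show ?thesis
      using real that[of "x + 1" "r - x - 1"] by simp
  next
    fix y assume "A = - \<infinity>" "B = ereal y"
    then show ?thesis
      using real that[of "r - y - 1" "y + 1"] by simp
  next
    assume "A = - \<infinity>" "B = - \<infinity>"
    then show ?thesis
      using real that[of r 0] by simp
  qed (use assms in auto)
next
  case PInf
  obtain s t where "A < ereal s" "B < ereal t"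
    using ereal_dense2[OF assms(1)] ereal_dense2[OF assms(2)] by blast
  then show ?thesis
    using that PInf by simp
qed (use assms in auto)

text \<open>Dual to \<open>ereal_add_less_realE\<close> by negation, since well-definedness makes
  \<open>- (A + B)\<close> equal to \<open>- A + - B\<close>. The strict gap between
  \<open>u\<close> and \<open>a + b\<close> is later spent on the change of exponent in the lower
  bound.\<close>

lemma ereal_less_add_realE:
  fixes A B P :: ereal
  assumes "sum_well_defined A B" "P < A + B"
  obtains a b u where "ereal a < A" "ereal b < B" "P < ereal u" "u < a + b"
proof -
  have "- A < \<infinity>" "- B < \<infinity>"
    using assms by (cases A; cases B; auto simp: sum_well_defined_def)+
  moreover from assms obtain u where u: "P < ereal u" "ereal u < A + B"
    using ereal_dense2 by blast
  then have "- A + - B < - ereal u"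
    using assms(1) by (cases A; cases B) (auto simp: sum_well_defined_def)
  then obtain v where v: "- A + - B < ereal v" "ereal v < - ereal u"
    using ereal_dense2 by blast
  ultimately obtain s t where st: "- A < ereal s" "- B < ereal t" "ereal s + ereal t \<le> ereal v"
    using ereal_add_less_realE by blast
  then have "ereal (- s) < A" "ereal (- t) < B"
    by (cases A; cases B; simp)+
  moreover have "u < - s + - t"
    using st(3) v(2) by simp
  ultimately show ?thesis
    using that u(1) by blast
qed

subsection \<open>Bowen metrics and pre-measures\<close>

lemma iter_mspace:
  assumes "NDS X T" "x \<in> mspace (X 0)"
  shows "iter T j x \<in> mspace (X j)"
proof (induction j)
  case (Suc j)
  then show ?case
    using assms(1) continuous_map_funspace[of "mtopology_of (X j)" "mtopology_of (X (Suc j))" "T j"]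
    by (auto simp: NDS_def)
qed (use assms in simp)

lemma bowen_dist_less_iff:
  "0 < n \<Longrightarrow> bowen_dist X T n x y < e \<longleftrightarrow> (\<forall>j<n. mdist (X j) (iter T j x) (iter T j y) < e)"
  unfolding bowen_dist_def by (subst Max_less_iff) auto

lemma bowen_dist_le_iff:
  "0 < n \<Longrightarrow> bowen_dist X T n x y \<le> e \<longleftrightarrow> (\<forall>j<n. mdist (X j) (iter T j x) (iter T j y) \<le> e)"
  unfolding bowen_dist_def by (subst Max_le_iff) auto

lemma bowen_dist_commute: "bowen_dist X T n x y = bowen_dist X T n y x"
  by (simp add: bowen_dist_def mdist_commute)

lemma bowen_dist_self [simp]:
  assumes "NDS X T" "0 < n" "x \<in> mspace (X 0)"
  shows "bowen_dist X T n x x = 0"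
proof -
  have "(\<lambda>j. mdist (X j) (iter T j x) (iter T j x)) ` {..<n} = {0}"
    using assms by (auto simp: iter_mspace)
  then show ?thesis
    by (simp add: bowen_dist_def)
qed

lemma bowen_dist_triangle:
  assumes "NDS X T" "0 < n" and in_X: "x \<in> mspace (X 0)" "y \<in> mspace (X 0)" "z \<in> mspace (X 0)"
  shows "bowen_dist X T n x z \<le> bowen_dist X T n x y + bowen_dist X T n y z"
  unfolding bowen_dist_le_iff[OF \<open>0 < n\<close>]
proof safe
  fix j assume "j < n"
  have "mdist (X j) (iter T j x) (iter T j z)
      \<le> mdist (X j) (iter T j x) (iter T j y) + mdist (X j) (iter T j y) (iter T j z)"
    by (intro mdist_triangle iter_mspace[OF assms(1)] in_X)
  moreover have "mdist (X j) (iter T j u) (iter T j v) \<le> bowen_dist X T n u v" for u v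
    using bowen_dist_le_iff[OF \<open>0 < n\<close>, of X T u v "bowen_dist X T n u v"] \<open>j < n\<close> by simp
  ultimately show "mdist (X j) (iter T j x) (iter T j z) \<le> bowen_dist X T n x y + bowen_dist X T n y z"
    by (meson add_mono order_trans)
qed

section \<open>Product systems: iterates, balls and weights\<close>

lemma iter_prod_maps: "iter (prod_maps T R) j (x, y) = (iter T j x, iter R j y)"
  by (induction j) (auto simp: prod_maps_def)

text \<open>The maximum of the product metric commutes with the maximum over the times
  \<open>j < n\<close>. For \<open>n = 0\<close> the Bowen distance is an unspecified value, hence
  the positive order.\<close>

lemma bowen_ball_prod:
  assumes "0 < n"
  shows "bowen_ball (prod_spaces X Y) (prod_maps T R) n (x, y) e = bowen_ball X T n x e \<times> bowen_ball Y R n y e"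
  using assms by (auto simp: bowen_ball_def bowen_dist_less_iff iter_prod_maps prod_spaces_def)

text \<open>Birkhoff sums of \<open>dotplus f g\<close> split into the two coordinates, and the
  exponential turns this sum into a product. This is where the exponents of the two factors get
  added.\<close>

lemma weight_prod:
  "weight (prod_maps T R) (dotplus f g) (s + t) n (x, y) = weight T f s n x * weight R g t n y"
  by (simp add: weight_def birkhoff_sum_def iter_prod_maps dotplus_def sum.distrib algebra_simps
      flip: ennreal_mult exp_add)

lemma weight_add: "weight T f (s + t) n x = ennreal (exp (- real n * t)) * weight T f s n x"
  by (simp add: weight_def algebra_simps flip: ennreal_mult exp_add)

lemma weight_antimono: "s \<le> t \<Longrightarrow> weight T f t n x \<le> weight T f s n x"
  unfolding weight_def by (intro ennreal_leI) (simp add: mult_left_mono)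

text \<open>Enumerating \<open>I\<close> carries the family over to the index sets of naturals of
  the definition, so that later covers can be indexed directly by pairs such as an order and a
  centre.\<close>

lemma bowen_pre_le:
  fixes I :: "'i set"
  assumes "countable I" and I: "\<And>i. i \<in> I \<Longrightarrow> N \<le> n i \<and> x i \<in> mspace (X 0)"
    and cover: "Z \<subseteq> (\<Union>i\<in>I. bowen_ball X T (n i) (x i) \<epsilon>)"
  shows "bowen_pre X T f Z s N \<epsilon> \<le> (\<integral>\<^sup>+i. weight T f s (n i) (x i) \<partial>count_space I)"
proof -
  define J where "J = to_nat_on I ` I"
  define h where "h = inv_into I (to_nat_on I)"
  have h: "bij_betw h J I"
    unfolding J_def h_def using inj_on_to_nat_on[OF assms(1)]
    by (intro bij_betw_inv_into) (simp add: bij_betw_def)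
  have "(\<Sum>\<^sub>\<infinity>j\<in>J. weight T f s (n (h j)) (x (h j))) = (\<integral>\<^sup>+i. weight T f s (n i) (x i) \<partial>count_space I)"
    using nn_integral_bij_count_space[OF h, of "\<lambda>i. weight T f s (n i) (x i)"]
    by (simp add: infsum_eq_nn_integral_count_space)
  moreover have "(\<forall>j\<in>J. N \<le> n (h j) \<and> x (h j) \<in> mspace (X 0)) \<and>
      Z \<subseteq> (\<Union>j\<in>J. bowen_ball X T (n (h j)) (x (h j)) \<epsilon>)"
    using I cover h unfolding bij_betw_def by blast
  ultimately show ?thesis
    unfolding bowen_pre_def by (intro Inf_lower CollectI exI[of _ J] exI[of _ "n \<circ> h"] exI[of _ "x \<circ> h"]) auto
qed

lemma bowen_pre_lessE:
  assumes "bowen_pre X T f Z s N \<epsilon> < a"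
  obtains I :: "nat set" and n x
  where "\<forall>i\<in>I. N \<le> n i \<and> x i \<in> mspace (X 0)"
    "Z \<subseteq> (\<Union>i\<in>I. bowen_ball X T (n i) (x i) \<epsilon>)"
    "(\<integral>\<^sup>+i. weight T f s (n i) (x i) \<partial>count_space I) < a"
  using assms unfolding bowen_pre_def Inf_less_iff
  by (auto simp: infsum_eq_nn_integral_count_space)

lemma packing_pre_ge:
  fixes I :: "'i set"
  assumes "countable I" and I: "\<And>i. i \<in> I \<Longrightarrow> N \<le> n i \<and> x i \<in> Z"
    and disj: "disjoint_family_on (\<lambda>i. bowen_cball X T (n i) (x i) \<epsilon>) I"
  shows "(\<integral>\<^sup>+i. weight T f s (n i) (x i) \<partial>count_space I) \<le> packing_pre X T f Z s N \<epsilon>"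
proof -
  define J where "J = to_nat_on I ` I"
  define h where "h = inv_into I (to_nat_on I)"
  have h: "bij_betw h J I"
    unfolding J_def h_def using inj_on_to_nat_on[OF assms(1)]
    by (intro bij_betw_inv_into) (simp add: bij_betw_def)
  have "(\<Sum>\<^sub>\<infinity>j\<in>J. weight T f s (n (h j)) (x (h j))) = (\<integral>\<^sup>+i. weight T f s (n i) (x i) \<partial>count_space I)"
    using nn_integral_bij_count_space[OF h, of "\<lambda>i. weight T f s (n i) (x i)"]
    by (simp add: infsum_eq_nn_integral_count_space)
  moreover have "(\<forall>j\<in>J. N \<le> n (h j) \<and> x (h j) \<in> Z)"
    using I h unfolding bij_betw_def by blast
  moreover have "disjoint_family_on (\<lambda>j. bowen_cball X T (n (h j)) (x (h j)) \<epsilon>) J"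
    using disj h unfolding disjoint_family_on_def bij_betw_def inj_on_def by blast
  ultimately show ?thesis
    unfolding packing_pre_def by (intro Sup_upper CollectI exI[of _ J] exI[of _ "n \<circ> h"] exI[of _ "x \<circ> h"]) auto
qed

text \<open>A maximal family of disjoint closed balls of one fixed order is a packing, which bounds
  its weight, and tripling its radii gives a cover.\<close>

lemma packing_pre_spanningE:
  assumes "NDS X T" "Z \<subseteq> mspace (X 0)" "0 < n" "N \<le> n" "0 < \<epsilon>"
    and fin: "packing_pre X T f Z s N \<epsilon> < \<infinity>"
  obtains S where "countable S" "S \<subseteq> Z" "Z \<subseteq> (\<Union>x\<in>S. bowen_ball X T n x (3 * \<epsilon>))"
    "(\<integral>\<^sup>+x. weight T f s n x \<partial>count_space S) \<le> packing_pre X T f Z s N \<epsilon>"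
proof -
  let ?r = "\<lambda>x y. bowen_cball X T n x \<epsilon> \<inter> bowen_cball X T n y \<epsilon> = {}"
  have "symp ?r"
    by (auto simp: symp_def)
  then obtain S where S: "S \<subseteq> Z" "pairwise ?r S" and max: "\<And>x. x \<in> Z - S \<Longrightarrow> \<exists>y\<in>S. \<not> ?r x y"
    using maximal_pairwiseE by blast
  have le: "(\<integral>\<^sup>+x. weight T f s n x \<partial>count_space F) \<le> packing_pre X T f Z s N \<epsilon>"
    if "F \<subseteq> S" "countable F" for F
  proof (rule packing_pre_ge)
    show "disjoint_family_on (\<lambda>x. bowen_cball X T n x \<epsilon>) F"
      unfolding disjoint_family_on_def using that pairwiseD[OF S(2)] by blast
  qed (use that S \<open>N \<le> n\<close> in auto)
  define w where "w x = exp (- real n * s + birkhoff_sum T f n x)" for x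
  have w: "weight T f s n x = ennreal (w x)" "0 < w x" for x
    by (simp_all add: weight_def w_def)
  \<comment> \<open>\<open>S\<close> comes from Zorn's lemma and might be uncountable, whereas
    packings are countable. Finite subfamilies are packings, so their weight sums have a common
    bound; the positive weights are then summable, which forces \<open>S\<close> to be
    countable.\<close>
  have "sum w F \<le> enn2real (packing_pre X T f Z s N \<epsilon>)" if F: "F \<subseteq> S" "finite F" for F
  proof -
    have "ennreal (sum w F) = (\<integral>\<^sup>+x. weight T f s n x \<partial>count_space F)"
      using F by (simp add: nn_integral_count_space_finite w less_imp_le)
    also have "\<dots> \<le> packing_pre X T f Z s N \<epsilon>"
      using F by (intro le) (auto intro: countable_finite)
    finally have "enn2real (ennreal (sum w F)) \<le> enn2real (packing_pre X T f Z s N \<epsilon>)"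
      using fin by (intro enn2real_mono) auto
    then show ?thesis
      using w(2) by (simp add: sum_nonneg less_imp_le)
  qed
  then have "bdd_above (sum w ` {F. F \<subseteq> S \<and> finite F})"
    by (intro bdd_aboveI) auto
  then have "w summable_on S"
    using w(2) by (intro nonneg_bdd_above_summable_on) (auto intro: less_imp_le)
  then have "countable {x \<in> S. w x \<noteq> 0}"
    using summable_countable_real by blast
  moreover have "{x \<in> S. w x \<noteq> 0} = S"
    using w(2) by (auto simp: less_le)
  ultimately have "countable S"
    by simp
  moreover have "Z \<subseteq> (\<Union>x\<in>S. bowen_ball X T n x (3 * \<epsilon>))"
  proof
    fix z assume z: "z \<in> Z"
    show "z \<in> (\<Union>x\<in>S. bowen_ball X T n x (3 * \<epsilon>))"
    proof (cases "z \<in> S")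
      case True
      then show ?thesis
        using assms z by (intro UN_I[of z]) (auto simp: bowen_ball_def)
    next
      case False
      then obtain y u where y: "y \<in> S" "u \<in> bowen_cball X T n z \<epsilon>" "u \<in> bowen_cball X T n y \<epsilon>"
        using max[of z] z by blast
      then have "bowen_dist X T n y z \<le> bowen_dist X T n y u + bowen_dist X T n u z"
        using S z assms by (intro bowen_dist_triangle) (auto simp: bowen_cball_def)
      \<comment> \<open>Two closed balls that meet have centres at distance at most
        \<open>2 * \<epsilon>\<close>; the factor 3 yields the strict inequality of an open
        ball.\<close>
      also have "\<dots> < 3 * \<epsilon>"
        using y \<open>0 < \<epsilon>\<close> by (simp add: bowen_cball_def bowen_dist_commute[of X T n u z])
      finally show ?thesis
        using y z assms by (auto simp: bowen_ball_def)
    qed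
  qed
  ultimately show ?thesis
    using that S(1) le[of S] by auto
qed

text \<open>By \<open>bowen_pre_mono\<close> the pre-measures increase to their limit, so a zero
  limit forces each of them to vanish; conversely the limit is determined beyond any chosen
  \<open>K\<close>.\<close>

lemma bowen_measure_eq_0_iff:
  "bowen_measure X T f Z s \<epsilon> = 0 \<longleftrightarrow> (\<forall>N\<ge>K. bowen_pre X T f Z s N \<epsilon> = 0)"
proof
  assume "bowen_measure X T f Z s \<epsilon> = 0"
  moreover have "bowen_pre X T f Z s N \<epsilon> \<le> bowen_measure X T f Z s \<epsilon>" for N
    by (intro incseq_le bowen_measure_limit) (auto simp: incseq_def intro: bowen_pre_mono)
  ultimately show "\<forall>N\<ge>K. bowen_pre X T f Z s N \<epsilon> = 0"
    by simp
next
  assume "\<forall>N\<ge>K. bowen_pre X T f Z s N \<epsilon> = 0"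
  then have "(\<lambda>N. bowen_pre X T f Z s N \<epsilon>) \<longlonglongrightarrow> 0"
    by (intro tendsto_eventually) (auto simp: eventually_sequentially)
  then show "bowen_measure X T f Z s \<epsilon> = 0"
    by (rule LIMSEQ_unique[OF bowen_measure_limit])
qed

text \<open>Countable subadditivity for null sets: covers of small weight, one for each
  \<open>A k\<close>, are merged into a single cover indexed by pairs.\<close>

lemma bowen_pre_UN_eq_0:
  fixes A :: "nat \<Rightarrow> 'a set"
  assumes "\<And>k. bowen_pre X T f (A k) s N \<epsilon> = 0"
  shows "bowen_pre X T f (\<Union>k. A k) s N \<epsilon> = 0"
proof -
  have "bowen_pre X T f (\<Union>k. A k) s N \<epsilon> \<le> 0 + ennreal e" if "0 < e" for e
  proof -
    \<comment> \<open>A geometric budget with total \<open>e\<close>, as the powers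
      \<open>(1/2) ^ Suc k\<close> sum to 1.\<close>
    define a where "a k = ennreal (e * (1/2) ^ Suc k)" for k
    let ?Q = "\<lambda>k (I :: nat set) n x. (\<forall>i\<in>I. N \<le> n i \<and> x i \<in> mspace (X 0)) \<and>
        A k \<subseteq> (\<Union>i\<in>I. bowen_ball X T (n i) (x i) \<epsilon>) \<and>
        (\<integral>\<^sup>+i. weight T f s (n i) (x i) \<partial>count_space I) < a k"
    have "\<exists>I n x. ?Q k I n x" for k
    proof -
      have "bowen_pre X T f (A k) s N \<epsilon> < a k"
        using assms that by (simp add: a_def)
      then show ?thesis
        by (elim bowen_pre_lessE) blast
    qed
    then have "\<forall>k. \<exists>I n x. ?Q k I n x"
      by (rule allI)
    then have "\<exists>I n x. \<forall>k. ?Q k (I k) (n k) (x k)"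
      by (simp only: choice_iff)
    then obtain I n x where Q: "\<forall>k. ?Q k (I k) (n k) (x k)"
      by (elim exE)
    then have I: "N \<le> n k i \<and> x k i \<in> mspace (X 0)" if "i \<in> I k" for k i
      using that by simp
    from Q have cover: "A k \<subseteq> (\<Union>i\<in>I k. bowen_ball X T (n k i) (x k i) \<epsilon>)" for k
      by simp
    from Q have less: "(\<integral>\<^sup>+i. weight T f s (n k i) (x k i) \<partial>count_space (I k)) < a k" for k
      by simp
    have "bowen_pre X T f (\<Union>k. A k) s N \<epsilon> \<le>
        (\<integral>\<^sup>+p. weight T f s (n (fst p) (snd p)) (x (fst p) (snd p)) \<partial>count_space (Sigma UNIV I))"
      using I cover by (intro bowen_pre_le) (auto, blast)
    also have "\<dots> = (\<Sum>k. \<integral>\<^sup>+i. weight T f s (n k i) (x k i) \<partial>count_space (I k))"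
      by (simp add: nn_integral_count_space_Sigma nn_integral_count_space_nat)
    also have "\<dots> \<le> (\<Sum>k. a k)"
      using less by (intro suminf_le) (auto intro: less_imp_le)
    also have "\<dots> = ennreal e"
    proof -
      have "(\<lambda>k. e * (1/2) ^ Suc k) sums (e * 1)"
        by (intro sums_mult power_half_series)
      then show ?thesis
        unfolding a_def using that by (intro sums_unique[symmetric]) (auto simp: sums_ennreal)
    qed
    finally show ?thesis by simp
  qed
  then have "bowen_pre X T f (\<Union>k. A k) s N \<epsilon> \<le> 0"
    by (rule ennreal_le_epsilon)
  then show ?thesis by simp
qed

text \<open>The same covers are admissible for both exponents and \<open>weight\<close> decreases in
  the exponent. Hence the exponents of measure zero are upward closed.\<close>

lemma bowen_measure_antimono:
  assumes "s \<le> t"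
  shows "bowen_measure X T f Z t \<epsilon> \<le> bowen_measure X T f Z s \<epsilon>"
proof -
  have "bowen_pre X T f Z t N \<epsilon> \<le> bowen_pre X T f Z s N \<epsilon>" for N
  proof (rule dense_ge)
    fix a assume "bowen_pre X T f Z s N \<epsilon> < a"
    then obtain I :: "nat set" and n x
      where I: "\<forall>i\<in>I. N \<le> n i \<and> x i \<in> mspace (X 0)"
        "Z \<subseteq> (\<Union>i\<in>I. bowen_ball X T (n i) (x i) \<epsilon>)"
        and less: "(\<integral>\<^sup>+i. weight T f s (n i) (x i) \<partial>count_space I) < a"
      by (rule bowen_pre_lessE)
    have "bowen_pre X T f Z t N \<epsilon> \<le> (\<integral>\<^sup>+i. weight T f t (n i) (x i) \<partial>count_space I)"
      using I by (intro bowen_pre_le) auto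
    also have "\<dots> \<le> (\<integral>\<^sup>+i. weight T f s (n i) (x i) \<partial>count_space I)"
      by (intro nn_integral_mono weight_antimono assms)
    finally show "bowen_pre X T f Z t N \<epsilon> \<le> a"
      using less by simp
  qed
  then show ?thesis
    by (intro LIMSEQ_le[OF bowen_measure_limit bowen_measure_limit]) auto
qed

lemma packing_measure_antimono:
  assumes "s \<le> t"
  shows "packing_measure X T f Z t \<epsilon> \<le> packing_measure X T f Z s \<epsilon>"
proof -
  have "packing_pre X T f V t N \<epsilon> \<le> packing_pre X T f V s N \<epsilon>" for V N
    unfolding packing_pre_def[of X T f V t]
  proof (rule Sup_least, safe)
    fix I :: "nat set" and n x
    assume I: "\<forall>i\<in>I. N \<le> n i \<and> x i \<in> V"
      "disjoint_family_on (\<lambda>i. bowen_cball X T (n i) (x i) \<epsilon>) I"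
    have "(\<Sum>\<^sub>\<infinity>i\<in>I. weight T f t (n i) (x i)) \<le> (\<integral>\<^sup>+i. weight T f s (n i) (x i) \<partial>count_space I)"
      by (auto simp: infsum_eq_nn_integral_count_space intro!: nn_integral_mono weight_antimono assms)
    also have "\<dots> \<le> packing_pre X T f V s N \<epsilon>"
      using I by (intro packing_pre_ge) auto
    finally show "(\<Sum>\<^sub>\<infinity>i\<in>I. weight T f t (n i) (x i)) \<le> packing_pre X T f V s N \<epsilon>" .
  qed
  then have "packing_premeasure X T f V t \<epsilon> \<le> packing_premeasure X T f V s \<epsilon>" for V
    by (intro LIMSEQ_le[OF packing_premeasure_limit packing_premeasure_limit]) auto
  then have "(\<Sum>i. packing_premeasure X T f (Zs i) t \<epsilon>) \<le> (\<Sum>i. packing_premeasure X T f (Zs i) s \<epsilon>)" for Zs :: "nat \<Rightarrow> _"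
    by (intro suminf_le) auto
  then show ?thesis
    unfolding packing_measure_def by (intro Inf_mono) blast
qed

section \<open>Pressures as critical exponents and as suprema over radii\<close>

lemma bowen_measure_eq_0:
  assumes "bowen_pressure_at X T f Z \<epsilon> < ereal s"
  shows "bowen_measure X T f Z s \<epsilon> = 0"
proof -
  obtain s' where "s' < s" "bowen_measure X T f Z s' \<epsilon> = 0"
    using assms by (auto simp: bowen_pressure_at_def Inf_less_iff)
  then show ?thesis
    using bowen_measure_antimono[of s' s X T f Z \<epsilon>] by simp
qed

lemma packing_measure_eq_0:
  assumes "packing_pressure_at X T f Z \<epsilon> < ereal s"
  shows "packing_measure X T f Z s \<epsilon> = 0"
proof -
  obtain s' where "s' < s" "packing_measure X T f Z s' \<epsilon> = 0"
    using assms by (auto simp: packing_pressure_at_def Inf_less_iff)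
  then show ?thesis
    using packing_measure_antimono[of s' s X T f Z \<epsilon>] by simp
qed

lemma bowen_pressure_at_le: "bowen_measure X T f Z s \<epsilon> = 0 \<Longrightarrow> bowen_pressure_at X T f Z \<epsilon> \<le> ereal s"
  unfolding bowen_pressure_at_def by (intro Inf_lower) blast

text \<open>Shrinking the radius raises the pressure, so its limit at 0 is a supremum. A single
  radius then witnesses that the pressure exceeds a given number.\<close>

lemma bowen_pressure_eq_SUP: "bowen_pressure X T f Z = (SUP \<epsilon>\<in>{0<..}. bowen_pressure_at X T f Z \<epsilon>)"
  using tendsto_unique[OF _ bowen_pressure_limit tendsto_at_right_0_antimono] bowen_pressure_at_antimono
  by (metis trivial_limit_at_right_real)

lemma packing_pressure_eq_SUP: "packing_pressure X T f Z = (SUP \<epsilon>\<in>{0<..}. packing_pressure_at X T f Z \<epsilon>)"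
  using tendsto_unique[OF _ packing_pressure_limit tendsto_at_right_0_antimono] packing_pressure_at_antimono
  by (metis trivial_limit_at_right_real)

lemma bowen_pre_mono_set:
  assumes "Z \<subseteq> Z'"
  shows "bowen_pre X T f Z s N \<epsilon> \<le> bowen_pre X T f Z' s N \<epsilon>"
proof (rule dense_ge)
  fix a assume "bowen_pre X T f Z' s N \<epsilon> < a"
  then obtain I :: "nat set" and n x
    where "\<forall>i\<in>I. N \<le> n i \<and> x i \<in> mspace (X 0)" "Z' \<subseteq> (\<Union>i\<in>I. bowen_ball X T (n i) (x i) \<epsilon>)"
      and less: "(\<integral>\<^sup>+i. weight T f s (n i) (x i) \<partial>count_space I) < a"
    by (rule bowen_pre_lessE)
  then have "bowen_pre X T f Z s N \<epsilon> \<le> (\<integral>\<^sup>+i. weight T f s (n i) (x i) \<partial>count_space I)"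
    using assms by (intro bowen_pre_le) auto
  with less show "bowen_pre X T f Z s N \<epsilon> \<le> a"
    by simp
qed

subsection \<open>The upper bound\<close>

lemma packing_premeasure_lessE:
  assumes "packing_premeasure X T f Z s \<epsilon> < a"
  obtains K where "\<And>N. K \<le> N \<Longrightarrow> packing_pre X T f Z s N \<epsilon> < a"
  using order_tendstoD(2)[OF packing_premeasure_limit assms] that
  by (auto simp: eventually_sequentially)

text \<open>Each ball of order \<open>n i\<close> covering part of \<open>Z\<close> is paired with a
  spanning set of \<open>V\<close> of the same order, as product balls have one order. Each spanning
  set has total weight at most 1, so the product cover weighs no more than the cover of
  \<open>Z\<close>, which is arbitrarily light.\<close>

lemma bowen_pre_prod_eq_0:
  assumes "NDS Y R" "V \<subseteq> mspace (Y 0)" "0 < \<epsilon>" "0 < N"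
    and Z0: "bowen_pre X T f Z s N \<epsilon> = 0"
    and V1: "packing_pre Y R g V t N \<epsilon> \<le> 1"
  shows "bowen_pre (prod_spaces X Y) (prod_maps T R) (dotplus f g) (Z \<times> V) (s + t) N (3 * \<epsilon>) = 0"
    (is "?P = 0")
proof -
  have "?P \<le> a" if "0 < a" for a
  proof -
    have "bowen_pre X T f Z s N \<epsilon> < a"
      using Z0 that by simp
    then obtain I :: "nat set" and n x
      where I: "\<forall>i\<in>I. N \<le> n i \<and> x i \<in> mspace (X 0)"
        "Z \<subseteq> (\<Union>i\<in>I. bowen_ball X T (n i) (x i) \<epsilon>)"
        and less: "(\<integral>\<^sup>+i. weight T f s (n i) (x i) \<partial>count_space I) < a"
      by (rule bowen_pre_lessE) blast
    have "\<forall>i\<in>I. \<exists>S. countable S \<and> S \<subseteq> V \<and> V \<subseteq> (\<Union>y\<in>S. bowen_ball Y R (n i) y (3 * \<epsilon>)) \<and>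
        (\<integral>\<^sup>+y. weight R g t (n i) y \<partial>count_space S) \<le> 1"
    proof
      fix i assume "i \<in> I"
      then have "0 < n i" "N \<le> n i"
        using I(1) \<open>0 < N\<close> by (force, blast)
      moreover have "packing_pre Y R g V t N \<epsilon> < \<infinity>"
        using V1 by (simp add: order_le_less_trans)
      ultimately obtain S where "countable S" "S \<subseteq> V" "V \<subseteq> (\<Union>y\<in>S. bowen_ball Y R (n i) y (3 * \<epsilon>))"
        "(\<integral>\<^sup>+y. weight R g t (n i) y \<partial>count_space S) \<le> packing_pre Y R g V t N \<epsilon>"
        by (rule packing_pre_spanningE[OF assms(1,2) _ _ \<open>0 < \<epsilon>\<close>])
      with V1 show "\<exists>S. countable S \<and> S \<subseteq> V \<and> V \<subseteq> (\<Union>y\<in>S. bowen_ball Y R (n i) y (3 * \<epsilon>)) \<and>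
          (\<integral>\<^sup>+y. weight R g t (n i) y \<partial>count_space S) \<le> 1"
        by (intro exI[of _ S]) auto
    qed
    from bchoice[OF this] obtain S where S: "\<forall>i\<in>I. countable (S i) \<and> S i \<subseteq> V \<and>
        V \<subseteq> (\<Union>y\<in>S i. bowen_ball Y R (n i) y (3 * \<epsilon>)) \<and>
        (\<integral>\<^sup>+y. weight R g t (n i) y \<partial>count_space (S i)) \<le> 1"
      by (elim exE)
    have "Z \<times> V \<subseteq> (\<Union>p\<in>Sigma I S. bowen_ball (prod_spaces X Y) (prod_maps T R) (n (fst p)) (x (fst p), snd p) (3 * \<epsilon>))"
    proof safe
      fix z v assume "z \<in> Z" "v \<in> V"
      obtain i where i: "i \<in> I" "z \<in> bowen_ball X T (n i) (x i) \<epsilon>"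
        using I(2) \<open>z \<in> Z\<close> by blast
      moreover obtain y where y: "y \<in> S i" "v \<in> bowen_ball Y R (n i) y (3 * \<epsilon>)"
        using S i \<open>v \<in> V\<close> by blast
      moreover have "0 < n i"
        using I(1) i \<open>0 < N\<close> by force
      \<comment> \<open>Both factors of a product ball share one radius, so the balls covering
        \<open>Z\<close> are enlarged as well.\<close>
      moreover have "bowen_ball X T (n i) (x i) \<epsilon> \<subseteq> bowen_ball X T (n i) (x i) (3 * \<epsilon>)"
        using \<open>0 < \<epsilon>\<close> by (intro bowen_ball_mono) simp
      ultimately show "(z, v) \<in> (\<Union>p\<in>Sigma I S. bowen_ball (prod_spaces X Y) (prod_maps T R) (n (fst p)) (x (fst p), snd p) (3 * \<epsilon>))"
        by (intro UN_I[of "(i, y)"]) (auto simp: bowen_ball_prod)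
    qed
    moreover have "y \<in> mspace (Y 0)" if "i \<in> I" "y \<in> S i" for i y
      using that S \<open>V \<subseteq> mspace (Y 0)\<close> by (meson subsetD)
    ultimately have "?P \<le> (\<integral>\<^sup>+p. weight (prod_maps T R) (dotplus f g) (s + t) (n (fst p)) (x (fst p), snd p) \<partial>count_space (Sigma I S))"
      using I(1) S by (intro bowen_pre_le) (auto simp: prod_spaces_def intro!: countable_SIGMA)
    also have "\<dots> = (\<integral>\<^sup>+i. weight T f s (n i) (x i) * (\<integral>\<^sup>+y. weight R g t (n i) y \<partial>count_space (S i)) \<partial>count_space I)"
      by (simp add: nn_integral_count_space_Sigma weight_prod nn_integral_cmult)
    also have "\<dots> \<le> (\<integral>\<^sup>+i. weight T f s (n i) (x i) * 1 \<partial>count_space I)"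
      using S by (intro nn_integral_mono mult_left_mono) auto
    finally show ?thesis
      using less by simp
  qed
  then have "?P \<le> 0"
    by (rule dense_ge)
  then show ?thesis
    by simp
qed

lemma bowen_measure_prod_eq_0:
  fixes X :: "nat \<Rightarrow> 'a metric" and Y :: "nat \<Rightarrow> 'b metric"
  assumes "NDS Y R" "0 < \<epsilon>"
    and Z0: "bowen_measure X T f Z s \<epsilon> = 0"
    and W0: "packing_measure Y R g W t \<epsilon> = 0"
  shows "bowen_measure (prod_spaces X Y) (prod_maps T R) (dotplus f g) (Z \<times> W) (s + t) (3 * \<epsilon>) = 0"
proof -
  let ?pre = "\<lambda>A N. bowen_pre (prod_spaces X Y) (prod_maps T R) (dotplus f g) A (s + t) N (3 * \<epsilon>)"
  have "packing_measure Y R g W t \<epsilon> < 1"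
    using W0 by simp
  then obtain V :: "nat \<Rightarrow> 'b set" where V: "\<And>i. V i \<subseteq> mspace (Y 0)" "W \<subseteq> (\<Union>i. V i)"
    and sum: "(\<Sum>i. packing_premeasure Y R g (V i) t \<epsilon>) < 1"
    unfolding packing_measure_def Inf_less_iff by blast
  have "?pre (Z \<times> V k) N = 0" for k N
  proof -
    have "packing_premeasure Y R g (V k) t \<epsilon> \<le> (\<Sum>i. packing_premeasure Y R g (V i) t \<epsilon>)"
      using sum_le_suminf[of "\<lambda>i. packing_premeasure Y R g (V i) t \<epsilon>" "{k}"] by simp
    then have "packing_premeasure Y R g (V k) t \<epsilon> < 1"
      using sum by simp
    then obtain K where K: "\<And>N. K \<le> N \<Longrightarrow> packing_pre Y R g (V k) t N \<epsilon> < 1"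
      using packing_premeasure_lessE by blast
    \<comment> \<open>The threshold \<open>K\<close> depends on the piece \<open>k\<close>.
      Pre-measures increase with the order, so vanishing at \<open>max N (Suc K)\<close> gives
      vanishing at \<open>N\<close>, an order common to all pieces, as
      \<open>bowen_pre_UN_eq_0\<close> requires. \<open>Suc\<close> keeps the order
      positive.\<close>
    have "?pre (Z \<times> V k) N \<le> ?pre (Z \<times> V k) (max N (Suc K))"
      by (intro bowen_pre_mono) simp
    also have "\<dots> = 0"
    proof (intro bowen_pre_prod_eq_0 assms V)
      show "bowen_pre X T f Z s (max N (Suc K)) \<epsilon> = 0"
        using Z0 bowen_measure_eq_0_iff[of X T f Z s \<epsilon> 0] by simp
      show "packing_pre Y R g (V k) t (max N (Suc K)) \<epsilon> \<le> 1"
        using K[of "max N (Suc K)"] by (simp add: less_imp_le)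
    qed simp
    finally show ?thesis
      by simp
  qed
  then have 0: "?pre (\<Union>k. Z \<times> V k) N = 0" for N
    by (rule bowen_pre_UN_eq_0)
  have "?pre (Z \<times> W) N = 0" for N
  proof -
    have "?pre (Z \<times> W) N \<le> ?pre (\<Union>k. Z \<times> V k) N"
      using V(2) by (intro bowen_pre_mono_set) blast
    then show ?thesis
      by (simp add: 0)
  qed
  then show ?thesis
    by (subst bowen_measure_eq_0_iff[of _ _ _ _ _ _ 0]) simp
qed

lemma bowen_pressure_prod_le:
  assumes "NDS Y R"
  shows "bowen_pressure (prod_spaces X Y) (prod_maps T R) (dotplus f g) (Z \<times> W)
    \<le> bowen_pressure X T f Z + packing_pressure Y R g W"
    (is "?P \<le> ?A + ?B")
proof -
  have le: "?P \<le> ereal s + ereal t" if s: "?A < ereal s" and t: "?B < ereal t" for s t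
    unfolding bowen_pressure_eq_SUP[of "prod_spaces X Y"]
  proof (rule SUP_least)
    fix \<epsilon> :: real assume "\<epsilon> \<in> {0<..}"
    \<comment> \<open>\<open>bowen_measure_prod_eq_0\<close> triples the radius, so it is applied at
      \<open>\<epsilon> / 3\<close>.\<close>
    then have \<epsilon>: "0 < \<epsilon> / 3"
      by simp
    have "bowen_pressure_at X T f Z (\<epsilon> / 3) \<le> ?A" "packing_pressure_at Y R g W (\<epsilon> / 3) \<le> ?B"
      unfolding bowen_pressure_eq_SUP packing_pressure_eq_SUP
      by (intro SUP_upper; use \<epsilon> in simp)+
    then have "bowen_measure X T f Z s (\<epsilon> / 3) = 0" "packing_measure Y R g W t (\<epsilon> / 3) = 0"
      using s t by (auto intro!: bowen_measure_eq_0 packing_measure_eq_0)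
    from bowen_pressure_at_le[OF bowen_measure_prod_eq_0[OF assms \<epsilon> this]]
    show "bowen_pressure_at (prod_spaces X Y) (prod_maps T R) (dotplus f g) (Z \<times> W) \<epsilon> \<le> ereal s + ereal t"
      by simp
  qed
  show ?thesis
  proof (cases "?A = \<infinity> \<or> ?B = \<infinity>")
    case False
    then have fin: "?A < \<infinity>" "?B < \<infinity>"
      by auto
    show ?thesis
    proof (rule dense_ge)
      fix u assume "?A + ?B < u"
      then obtain s t where "?A < ereal s" "?B < ereal t" "ereal s + ereal t \<le> u"
        by (rule ereal_add_less_realE[OF fin])
      then show "?P \<le> u"
        using le order_trans by blast
    qed
  qed auto
qed

subsection \<open>Weighted covers and the lower bound\<close>

lemma birkhoff_sum_diff_le:
  assumes "NDS X T" and osc: "\<forall>k. \<forall>x\<in>mspace (X k). \<forall>y\<in>mspace (X k). mdist (X k) x y < \<epsilon> \<longrightarrow> \<bar>f k x - f k y\<bar> \<le> \<delta>"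
    and "0 < n" "x \<in> mspace (X 0)" "y \<in> bowen_ball X T n x \<epsilon>"
  shows "birkhoff_sum T f n y \<le> birkhoff_sum T f n x + real n * \<delta>"
proof -
  have "birkhoff_sum T f n y \<le> (\<Sum>j<n. f j (iter T j x) + \<delta>)"
    unfolding birkhoff_sum_def
  proof (rule sum_mono)
    fix j assume "j \<in> {..<n}"
    then have "mdist (X j) (iter T j x) (iter T j y) < \<epsilon>"
      using assms(3,5) by (simp add: bowen_ball_def bowen_dist_less_iff)
    moreover have "iter T j x \<in> mspace (X j)" "iter T j y \<in> mspace (X j)"
      using assms by (auto intro!: iter_mspace simp: bowen_ball_def)
    ultimately show "f j (iter T j y) \<le> f j (iter T j x) + \<delta>"
      using osc by (force simp: abs_le_iff)
  qed
  then show ?thesis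
    by (simp add: birkhoff_sum_def sum.distrib)
qed

text \<open>Over \<open>n\<close> times the Birkhoff sum changes by at most
  \<open>real n * \<delta>\<close>, which the raised exponent absorbs. This allows the centre of a
  ball to be replaced by one of its points.\<close>

lemma weight_le_of_bowen_ball:
  assumes "NDS X T" and "\<forall>k. \<forall>x\<in>mspace (X k). \<forall>y\<in>mspace (X k). mdist (X k) x y < \<epsilon> \<longrightarrow> \<bar>f k x - f k y\<bar> \<le> \<delta>"
    and "0 < n" "x \<in> mspace (X 0)" "y \<in> bowen_ball X T n x \<epsilon>"
  shows "weight T f (s + \<delta>) n y \<le> weight T f s n x"
  using birkhoff_sum_diff_le[OF assms]
  by (auto simp: weight_def algebra_simps intro!: ennreal_leI)

text \<open>Maximality makes \<open>E\<close> span \<open>A\<close> at radius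
  \<open>2 * \<epsilon>\<close>, while separation makes each ball of the weighted cover pay for at
  most one point of \<open>E\<close>.\<close>

lemma weighted_cover_levelE:
  fixes I :: "'i set" and c :: "'i \<Rightarrow> ennreal"
  assumes "NDS X T" "0 < n" "countable I" and x: "\<forall>i\<in>I. x i \<in> mspace (X 0)"
    and osc: "\<forall>k. \<forall>x\<in>mspace (X k). \<forall>y\<in>mspace (X k). mdist (X k) x y < \<epsilon> \<longrightarrow> \<bar>f k x - f k y\<bar> \<le> \<delta>"
    and "A \<subseteq> mspace (X 0)" "0 < \<epsilon>"
    and A: "\<forall>z\<in>A. ennreal (exp (- real n * \<delta>)) \<le> (\<integral>\<^sup>+i. c i * indicator (bowen_ball X T n (x i) \<epsilon>) z \<partial>count_space I)"
  obtains E where "countable E" "E \<subseteq> A" "A \<subseteq> (\<Union>e\<in>E. bowen_ball X T n e (2 * \<epsilon>))"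
    "(\<integral>\<^sup>+e. weight T f (s + 2 * \<delta>) n e \<partial>count_space E) \<le> (\<integral>\<^sup>+i. c i * weight T f s n (x i) \<partial>count_space I)"
proof -
  let ?B = "\<lambda>i. bowen_ball X T n (x i) \<epsilon>"
  have "symp (\<lambda>y z. 2 * \<epsilon> \<le> bowen_dist X T n y z)"
    by (auto simp: symp_def bowen_dist_commute)
  then obtain E where E: "E \<subseteq> A" "pairwise (\<lambda>y z. 2 * \<epsilon> \<le> bowen_dist X T n y z) E"
    and max: "\<And>a. a \<in> A - E \<Longrightarrow> \<exists>e\<in>E. \<not> 2 * \<epsilon> \<le> bowen_dist X T n a e"
    by (rule maximal_pairwiseE[of _ A]) blast
  have disj: "d = e" if "d \<in> E" "e \<in> E" "d \<in> ?B i" "e \<in> ?B i" "i \<in> I" for d e i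
  proof (rule ccontr)
    assume "d \<noteq> e"
    have "bowen_dist X T n d e \<le> bowen_dist X T n d (x i) + bowen_dist X T n (x i) e"
      using that E x assms by (intro bowen_dist_triangle) auto
    also have "\<dots> < 2 * \<epsilon>"
      using that(3,4) by (simp add: bowen_ball_def bowen_dist_commute[of X T n d])
    finally show False
      using pairwiseD[OF E(2) that(1,2) \<open>d \<noteq> e\<close>] by simp
  qed
  \<comment> \<open>The mass at \<open>e\<close> is positive, so some ball contains
    \<open>e\<close>. Choosing such a ball is injective by \<open>disj\<close>, so \<open>E\<close>
    inherits countability from \<open>I\<close>.\<close>
  have "\<exists>i\<in>I. e \<in> ?B i" if "e \<in> E" for e
  proof (rule ccontr)
    assume "\<not> (\<exists>i\<in>I. e \<in> ?B i)"
    then have "(\<integral>\<^sup>+i. c i * indicator (?B i) e \<partial>count_space I) = (\<integral>\<^sup>+i. 0 \<partial>count_space I)"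
      by (intro nn_integral_cong) auto
    then show False
      using A that E(1) by fastforce
  qed
  then have "\<forall>e\<in>E. \<exists>i. i \<in> I \<and> e \<in> ?B i"
    by blast
  from bchoice[OF this] obtain h where h: "\<forall>e\<in>E. h e \<in> I \<and> e \<in> ?B (h e)"
    by (elim exE)
  have "inj_on h E"
    by (rule inj_onI) (metis h disj)
  moreover have "countable (h ` E)"
    using h by (intro countable_subset[OF _ \<open>countable I\<close>]) auto
  ultimately have "countable E"
    using countable_image_inj_on by blast
  have cover: "A \<subseteq> (\<Union>e\<in>E. bowen_ball X T n e (2 * \<epsilon>))"
  proof
    fix a assume a: "a \<in> A"
    show "a \<in> (\<Union>e\<in>E. bowen_ball X T n e (2 * \<epsilon>))"
    proof (cases "a \<in> E")
      case True
      then show ?thesis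
        using assms a by (intro UN_I[of a]) (auto simp: bowen_ball_def)
    next
      case False
      then obtain e where "e \<in> E" "bowen_dist X T n e a < 2 * \<epsilon>"
        using max[of a] a by (auto simp: bowen_dist_commute[of X T n a] not_le)
      then show ?thesis
        using a \<open>A \<subseteq> mspace (X 0)\<close> by (auto simp: bowen_ball_def)
    qed
  qed
  \<comment> \<open>One \<delta> is exchanged for the mass at \<open>e\<close>, which is at least
    \<open>exp (- real n * \<delta>)\<close>; the other moves the centre from \<open>e\<close> to
    \<open>x i\<close> for each ball containing \<open>e\<close>.\<close>
  have point: "weight T f (s + 2 * \<delta>) n e \<le> (\<integral>\<^sup>+i. c i * weight T f s n (x i) * indicator (?B i) e \<partial>count_space I)"
    if "e \<in> E" for e
  proof -
    have "weight T f (s + 2 * \<delta>) n e = weight T f (s + \<delta>) n e * ennreal (exp (- real n * \<delta>))"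
      using weight_add[of T f "s + \<delta>" \<delta> n e] by (simp add: mult.commute add.assoc)
    also have "\<dots> \<le> weight T f (s + \<delta>) n e * (\<integral>\<^sup>+i. c i * indicator (?B i) e \<partial>count_space I)"
      using A that E(1) by (intro mult_left_mono zero_le) blast
    also have "\<dots> = (\<integral>\<^sup>+i. weight T f (s + \<delta>) n e * (c i * indicator (?B i) e) \<partial>count_space I)"
      by (simp add: nn_integral_cmult)
    also have "\<dots> \<le> (\<integral>\<^sup>+i. c i * weight T f s n (x i) * indicator (?B i) e \<partial>count_space I)"
    proof (rule nn_integral_mono)
      fix i assume i: "i \<in> space (count_space I)"
      show "weight T f (s + \<delta>) n e * (c i * indicator (?B i) e) \<le> c i * weight T f s n (x i) * indicator (?B i) e"
      proof (cases "e \<in> ?B i")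
        case True
        then have "weight T f (s + \<delta>) n e \<le> weight T f s n (x i)"
          using i x by (intro weight_le_of_bowen_ball[OF assms(1) osc \<open>0 < n\<close>]) auto
        then show ?thesis
          using True by (simp add: mult.commute mult_left_mono)
      qed simp
    qed
    finally show ?thesis .
  qed
  have "(\<integral>\<^sup>+e. weight T f (s + 2 * \<delta>) n e \<partial>count_space E) \<le>
      (\<integral>\<^sup>+e. (\<integral>\<^sup>+i. c i * weight T f s n (x i) * indicator (?B i) e \<partial>count_space I) \<partial>count_space E)"
    by (intro nn_integral_mono point) simp
  \<comment> \<open>Interchanging the sums leaves, for each ball, the number of points of
    \<open>E\<close> inside it, which is at most one by \<open>disj\<close>.\<close>
  also have "\<dots> = (\<integral>\<^sup>+i. (\<integral>\<^sup>+e. c i * weight T f s n (x i) * indicator (?B i) e \<partial>count_space E) \<partial>count_space I)"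
    using \<open>countable I\<close> by (intro nn_integral_count_space_nn_integral) auto
  also have "\<dots> \<le> (\<integral>\<^sup>+i. c i * weight T f s n (x i) \<partial>count_space I)"
  proof (rule nn_integral_mono)
    fix i assume i: "i \<in> space (count_space I)"
    have "(\<integral>\<^sup>+e. indicator (?B i) e \<partial>count_space E) \<le> (1 :: ennreal)"
    proof (cases "\<exists>d\<in>E. d \<in> ?B i")
      case True
      then obtain d where d: "d \<in> E" "d \<in> ?B i"
        by blast
      have "(\<integral>\<^sup>+e. indicator (?B i) e \<partial>count_space E) = (\<integral>\<^sup>+e. indicator {d} e \<partial>count_space E)"
        using disj d i by (intro nn_integral_cong) (auto simp: indicator_def)
      also have "\<dots> = (1 :: ennreal)"
        using d by simp
      finally show ?thesis
        by simp
    next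
      case False
      then have "(\<integral>\<^sup>+e. indicator (?B i) e \<partial>count_space E) = (\<integral>\<^sup>+e. 0 \<partial>count_space E)"
        by (intro nn_integral_cong) auto
      then show ?thesis
        by simp
    qed
    then have "c i * weight T f s n (x i) * (\<integral>\<^sup>+e. indicator (?B i) e \<partial>count_space E) \<le> c i * weight T f s n (x i) * 1"
      by (intro mult_left_mono) auto
    then show "(\<integral>\<^sup>+e. c i * weight T f s n (x i) * indicator (?B i) e \<partial>count_space E) \<le> c i * weight T f s n (x i)"
      by (simp add: nn_integral_cmult)
  qed
  finally show ?thesis
    using that \<open>countable E\<close> E(1) cover by blast
qed

text \<open>A pigeonhole argument over the orders reduces to a single order: mass at least 1 cannot
  stay below \<open>exp (- real m * \<delta>)\<close> at every order \<open>m\<close>, since by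
  \<open>tail\<close> these thresholds sum to less than 1. The covers found order by order are then
  merged.\<close>

lemma bowen_pre_le_weighted_cover:
  fixes I :: "'i set" and c :: "'i \<Rightarrow> ennreal"
  assumes "NDS X T" "0 < N" "countable I" and I: "\<And>i. i \<in> I \<Longrightarrow> N \<le> n i \<and> x i \<in> mspace (X 0)"
    and osc: "\<forall>k. \<forall>x\<in>mspace (X k). \<forall>y\<in>mspace (X k). mdist (X k) x y < \<epsilon> \<longrightarrow> \<bar>f k x - f k y\<bar> \<le> \<delta>"
    and "Z \<subseteq> mspace (X 0)" "0 < \<epsilon>"
    and cover: "\<And>z. z \<in> Z \<Longrightarrow> 1 \<le> (\<integral>\<^sup>+i. c i * indicator (bowen_ball X T (n i) (x i) \<epsilon>) z \<partial>count_space I)"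
    and tail: "(\<integral>\<^sup>+m. ennreal (exp (- real m * \<delta>)) \<partial>count_space {N..}) < 1"
  shows "bowen_pre X T f Z (s + 2 * \<delta>) N (2 * \<epsilon>) \<le> (\<integral>\<^sup>+i. c i * weight T f s (n i) (x i) \<partial>count_space I)"
proof -
  define J where "J m = {i \<in> I. n i = m}" for m
  define A where "A m = {z \<in> Z. ennreal (exp (- real m * \<delta>)) \<le>
    (\<integral>\<^sup>+i. c i * indicator (bowen_ball X T m (x i) \<epsilon>) z \<partial>count_space (J m))}" for m
  \<comment> \<open>The order is a separate argument of \<open>u\<close>, so one regrouping serves
    masses and weights alike and \<open>n i\<close> becomes the constant \<open>m\<close> on each
    fibre.\<close>
  have fibres: "(\<integral>\<^sup>+i. u (n i) i \<partial>count_space I) = (\<integral>\<^sup>+m. (\<integral>\<^sup>+i. u m i \<partial>count_space (J m)) \<partial>count_space {N..})"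
    for u :: "nat \<Rightarrow> 'i \<Rightarrow> ennreal"
  proof -
    have "(\<integral>\<^sup>+i. u (n i) i \<partial>count_space I) = (\<integral>\<^sup>+m. (\<integral>\<^sup>+i. u (n i) i \<partial>count_space (J m)) \<partial>count_space {N..})"
      unfolding J_def using I by (intro nn_integral_count_space_fibres) auto
    also have "\<dots> = (\<integral>\<^sup>+m. (\<integral>\<^sup>+i. u m i \<partial>count_space (J m)) \<partial>count_space {N..})"
      by (intro nn_integral_cong) (auto simp: J_def)
    finally show ?thesis .
  qed
  have Z: "Z \<subseteq> (\<Union>m\<in>{N..}. A m)"
  proof (rule subsetI, rule ccontr)
    fix z assume z: "z \<in> Z" "z \<notin> (\<Union>m\<in>{N..}. A m)"
    have "1 \<le> (\<integral>\<^sup>+m. (\<integral>\<^sup>+i. c i * indicator (bowen_ball X T m (x i) \<epsilon>) z \<partial>count_space (J m)) \<partial>count_space {N..})"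
      using cover[OF z(1)] fibres[of "\<lambda>m i. c i * indicator (bowen_ball X T m (x i) \<epsilon>) z"] by simp
    also have "\<dots> \<le> (\<integral>\<^sup>+m. ennreal (exp (- real m * \<delta>)) \<partial>count_space {N..})"
      using z by (intro nn_integral_mono) (auto simp: A_def not_le intro: less_imp_le)
    finally show False
      using tail by simp
  qed
  have "\<forall>m\<in>{N..}. \<exists>E. countable E \<and> E \<subseteq> A m \<and> A m \<subseteq> (\<Union>e\<in>E. bowen_ball X T m e (2 * \<epsilon>)) \<and>
    (\<integral>\<^sup>+e. weight T f (s + 2 * \<delta>) m e \<partial>count_space E) \<le> (\<integral>\<^sup>+i. c i * weight T f s m (x i) \<partial>count_space (J m))"
  proof
    fix m assume "m \<in> {N..}"
    then have "0 < m"
      using \<open>0 < N\<close> by simp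
    moreover have "countable (J m)"
      using \<open>countable I\<close> by (auto simp: J_def)
    moreover have "\<forall>i\<in>J m. x i \<in> mspace (X 0)"
      using I by (simp add: J_def)
    moreover have "A m \<subseteq> mspace (X 0)"
      using \<open>Z \<subseteq> mspace (X 0)\<close> by (auto simp: A_def)
    moreover have "\<forall>z\<in>A m. ennreal (exp (- real m * \<delta>)) \<le>
        (\<integral>\<^sup>+i. c i * indicator (bowen_ball X T m (x i) \<epsilon>) z \<partial>count_space (J m))"
      by (simp add: A_def)
    ultimately obtain E where "countable E" "E \<subseteq> A m" "A m \<subseteq> (\<Union>e\<in>E. bowen_ball X T m e (2 * \<epsilon>))"
      "(\<integral>\<^sup>+e. weight T f (s + 2 * \<delta>) m e \<partial>count_space E) \<le> (\<integral>\<^sup>+i. c i * weight T f s m (x i) \<partial>count_space (J m))"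
      by (rule weighted_cover_levelE[OF \<open>NDS X T\<close> _ _ _ osc _ \<open>0 < \<epsilon>\<close>])
    then show "\<exists>E. countable E \<and> E \<subseteq> A m \<and> A m \<subseteq> (\<Union>e\<in>E. bowen_ball X T m e (2 * \<epsilon>)) \<and>
        (\<integral>\<^sup>+e. weight T f (s + 2 * \<delta>) m e \<partial>count_space E) \<le> (\<integral>\<^sup>+i. c i * weight T f s m (x i) \<partial>count_space (J m))"
      by (intro exI[of _ E] conjI)
  qed
  from bchoice[OF this] obtain E where E: "\<forall>m\<in>{N..}. countable (E m) \<and> E m \<subseteq> A m \<and>
    A m \<subseteq> (\<Union>e\<in>E m. bowen_ball X T m e (2 * \<epsilon>)) \<and>
    (\<integral>\<^sup>+e. weight T f (s + 2 * \<delta>) m e \<partial>count_space (E m)) \<le> (\<integral>\<^sup>+i. c i * weight T f s m (x i) \<partial>count_space (J m))"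
    by (elim exE)
  have "bowen_pre X T f Z (s + 2 * \<delta>) N (2 * \<epsilon>) \<le>
      (\<integral>\<^sup>+p. weight T f (s + 2 * \<delta>) (fst p) (snd p) \<partial>count_space (Sigma {N..} E))"
  proof (rule bowen_pre_le)
    show "countable (Sigma {N..} E)"
      using E by (intro countable_SIGMA) auto
    show "N \<le> fst p \<and> snd p \<in> mspace (X 0)" if p: "p \<in> Sigma {N..} E" for p
    proof -
      have "snd p \<in> A (fst p)"
        using p E by (auto dest!: bspec[of _ _ "fst p"])
      then show ?thesis
        using p \<open>Z \<subseteq> mspace (X 0)\<close> by (auto simp: A_def)
    qed
    show "Z \<subseteq> (\<Union>p\<in>Sigma {N..} E. bowen_ball X T (fst p) (snd p) (2 * \<epsilon>))"
    proof
      fix z assume "z \<in> Z"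
      then obtain m where m: "N \<le> m" "z \<in> A m"
        using Z by auto
      then have "A m \<subseteq> (\<Union>e\<in>E m. bowen_ball X T m e (2 * \<epsilon>))"
        using E by simp
      with m(2) obtain e where "e \<in> E m" "z \<in> bowen_ball X T m e (2 * \<epsilon>)"
        by auto
      then show "z \<in> (\<Union>p\<in>Sigma {N..} E. bowen_ball X T (fst p) (snd p) (2 * \<epsilon>))"
        using m(1) by (intro UN_I[of "(m, e)"]) auto
    qed
  qed
  also have "\<dots> = (\<integral>\<^sup>+m. (\<integral>\<^sup>+e. weight T f (s + 2 * \<delta>) m e \<partial>count_space (E m)) \<partial>count_space {N..})"
    by (simp add: nn_integral_count_space_Sigma)
  also have "\<dots> \<le> (\<integral>\<^sup>+m. (\<integral>\<^sup>+i. c i * weight T f s m (x i) \<partial>count_space (J m)) \<partial>count_space {N..})"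
    using E by (intro nn_integral_mono) simp
  also have "\<dots> = (\<integral>\<^sup>+i. c i * weight T f s (n i) (x i) \<partial>count_space I)"
    by (rule fibres[symmetric])
  finally show ?thesis .
qed

text \<open>The slice of the product cover at a point \<open>z\<close> covers \<open>W\<close>, so
  the second factors of the balls whose first factor contains \<open>z\<close> weigh at least
  \<open>c\<close> in total. Dividing their weights by \<open>c\<close> gives a weighted cover of
  \<open>Z\<close>, and \<open>weight_prod\<close> recombines the two factors.\<close>

lemma bowen_pre_prod_ge:
  assumes "NDS X T" "0 < N" "Z \<subseteq> mspace (X 0)" "0 < \<epsilon>"
    and osc: "\<forall>k. \<forall>x\<in>mspace (X k). \<forall>y\<in>mspace (X k). mdist (X k) x y < \<epsilon> \<longrightarrow> \<bar>f k x - f k y\<bar> \<le> \<delta>"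
    and tail: "(\<integral>\<^sup>+m. ennreal (exp (- real m * \<delta>)) \<partial>count_space {N..}) < 1"
    and c: "0 < c" "c < \<infinity>" "c \<le> bowen_pre Y R g W t N \<epsilon>"
  shows "c * bowen_pre X T f Z (s + 2 * \<delta>) N (2 * \<epsilon>)
    \<le> bowen_pre (prod_spaces X Y) (prod_maps T R) (dotplus f g) (Z \<times> W) (s + t) N \<epsilon>"
proof (rule dense_ge)
  fix a
  assume "bowen_pre (prod_spaces X Y) (prod_maps T R) (dotplus f g) (Z \<times> W) (s + t) N \<epsilon> < a"
  then obtain I :: "nat set" and n p
    where I: "\<forall>i\<in>I. N \<le> n i \<and> p i \<in> mspace (prod_spaces X Y 0)"
      and cover: "Z \<times> W \<subseteq> (\<Union>i\<in>I. bowen_ball (prod_spaces X Y) (prod_maps T R) (n i) (p i) \<epsilon>)"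
      and less: "(\<integral>\<^sup>+i. weight (prod_maps T R) (dotplus f g) (s + t) (n i) (p i) \<partial>count_space I) < a"
    by (rule bowen_pre_lessE)
  define x where "x i = fst (p i)" for i
  define y where "y i = snd (p i)" for i
  have p: "p i = (x i, y i)" for i
    by (simp add: x_def y_def)
  have in_space: "N \<le> n i \<and> x i \<in> mspace (X 0)" "y i \<in> mspace (Y 0)" if "i \<in> I" for i
    using I that by (auto simp: p prod_spaces_def dest!: bspec)
  define d where "d i = weight R g t (n i) (y i) / c" for i
  have cd: "c * d i = weight R g t (n i) (y i)" for i
    using c ennreal_mult_divide_eq[of c "weight R g t (n i) (y i)"]
    by (simp add: d_def ennreal_times_divide mult.commute)
  have "1 \<le> (\<integral>\<^sup>+i. d i * indicator (bowen_ball X T (n i) (x i) \<epsilon>) z \<partial>count_space I)" if "z \<in> Z" for z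
  proof -
    let ?J = "{i \<in> I. z \<in> bowen_ball X T (n i) (x i) \<epsilon>}"
    have "W \<subseteq> (\<Union>i\<in>?J. bowen_ball Y R (n i) (y i) \<epsilon>)"
    proof
      fix w assume "w \<in> W"
      then have "(z, w) \<in> (\<Union>i\<in>I. bowen_ball (prod_spaces X Y) (prod_maps T R) (n i) (p i) \<epsilon>)"
        using cover that by blast
      then obtain i where i: "i \<in> I" "(z, w) \<in> bowen_ball (prod_spaces X Y) (prod_maps T R) (n i) (x i, y i) \<epsilon>"
        unfolding p by blast
      moreover have "0 < n i"
        using in_space(1)[OF i(1)] \<open>0 < N\<close> by simp
      ultimately show "w \<in> (\<Union>i\<in>?J. bowen_ball Y R (n i) (y i) \<epsilon>)"
        by (auto simp: bowen_ball_prod)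
    qed
    then have "bowen_pre Y R g W t N \<epsilon> \<le> (\<integral>\<^sup>+i. weight R g t (n i) (y i) \<partial>count_space ?J)"
      using in_space by (intro bowen_pre_le) auto
    also have "\<dots> = (\<integral>\<^sup>+i. weight R g t (n i) (y i) * indicator (bowen_ball X T (n i) (x i) \<epsilon>) z \<partial>count_space ?J)"
      by (intro nn_integral_cong) auto
    \<comment> \<open>The indicator vanishes outside \<open>?J\<close>, so the sum may run over all
      of \<open>I\<close>, independently of \<open>z\<close>.\<close>
    also have "\<dots> = (\<integral>\<^sup>+i. weight R g t (n i) (y i) * indicator (bowen_ball X T (n i) (x i) \<epsilon>) z \<partial>count_space I)"
      by (intro nn_integral_count_space_eq) auto
    also have "\<dots> = c * (\<integral>\<^sup>+i. d i * indicator (bowen_ball X T (n i) (x i) \<epsilon>) z \<partial>count_space I)"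
      by (simp add: cd flip: nn_integral_cmult mult.assoc)
    finally have "c * 1 \<le> c * (\<integral>\<^sup>+i. d i * indicator (bowen_ball X T (n i) (x i) \<epsilon>) z \<partial>count_space I)"
      using c(3) by simp
    then show ?thesis
      using c(1,2) by (subst (asm) ennreal_mult_le_mult_iff) auto
  qed
  then have "bowen_pre X T f Z (s + 2 * \<delta>) N (2 * \<epsilon>) \<le> (\<integral>\<^sup>+i. d i * weight T f s (n i) (x i) \<partial>count_space I)"
    using in_space(1) by (intro bowen_pre_le_weighted_cover[OF assms(1,2) _ _ osc assms(3,4) _ tail]) auto
  then have "c * bowen_pre X T f Z (s + 2 * \<delta>) N (2 * \<epsilon>) \<le> c * (\<integral>\<^sup>+i. d i * weight T f s (n i) (x i) \<partial>count_space I)"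
    by (intro mult_left_mono) auto
  also have "\<dots> = (\<integral>\<^sup>+i. weight R g t (n i) (y i) * weight T f s (n i) (x i) \<partial>count_space I)"
    by (simp add: cd flip: nn_integral_cmult mult.assoc)
  also have "\<dots> < a"
    using less by (simp add: p weight_prod mult.commute)
  finally show "c * bowen_pre X T f Z (s + 2 * \<delta>) N (2 * \<epsilon>) \<le> a"
    by simp
qed

lemma bowen_measure_fst_eq_0:
  assumes "NDS X T" "Z \<subseteq> mspace (X 0)" "0 < \<epsilon>" "0 < \<delta>"
    and osc: "\<forall>k. \<forall>x\<in>mspace (X k). \<forall>y\<in>mspace (X k). mdist (X k) x y < \<epsilon> \<longrightarrow> \<bar>f k x - f k y\<bar> \<le> \<delta>"
    and ZW: "bowen_measure (prod_spaces X Y) (prod_maps T R) (dotplus f g) (Z \<times> W) (s + t) \<epsilon> = 0"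
    and W: "bowen_measure Y R g W t \<epsilon> \<noteq> 0"
  shows "bowen_measure X T f Z (s + 2 * \<delta>) (2 * \<epsilon>) = 0"
proof -
  obtain K where K: "\<And>N. K \<le> N \<Longrightarrow> (\<integral>\<^sup>+m. ennreal (exp (- real m * \<delta>)) \<partial>count_space {N..}) < 1"
    using exp_tail_less_1E[OF \<open>0 < \<delta>\<close>] by blast
  obtain M where M: "bowen_pre Y R g W t M \<epsilon> \<noteq> 0"
    using W bowen_measure_eq_0_iff[of Y R g W t \<epsilon> 0] by auto
  \<comment> \<open>The pre-measure may be infinite; truncation at 1 gives a finite positive factor
    that bounds the pre-measures of all orders beyond \<open>M\<close> from below.\<close>
  define c where "c = min 1 (bowen_pre Y R g W t M \<epsilon>)"
  have c: "0 < c" "c < \<infinity>"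
    using M by (auto simp: c_def zero_less_iff_neq_zero min_less_iff_disj)
  \<comment> \<open>\<open>K\<close> secures the tail estimate, \<open>Suc\<close> a positive order,
    and \<open>M\<close> the lower bound \<open>c\<close>.\<close>
  have "bowen_pre X T f Z (s + 2 * \<delta>) N (2 * \<epsilon>) = 0" if N: "max (Suc K) M \<le> N" for N
  proof -
    have "c \<le> bowen_pre Y R g W t M \<epsilon>"
      by (simp add: c_def)
    also have "\<dots> \<le> bowen_pre Y R g W t N \<epsilon>"
      using N by (intro bowen_pre_mono) simp
    finally have "c * bowen_pre X T f Z (s + 2 * \<delta>) N (2 * \<epsilon>)
      \<le> bowen_pre (prod_spaces X Y) (prod_maps T R) (dotplus f g) (Z \<times> W) (s + t) N \<epsilon>"
      using N c K[of N] by (intro bowen_pre_prod_ge assms) auto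
    also have "\<dots> = 0"
      using ZW bowen_measure_eq_0_iff[of _ _ _ _ _ _ 0] by blast
    finally show ?thesis
      using c(1) by auto
  qed
  then show ?thesis
    by (subst bowen_measure_eq_0_iff[of _ _ _ _ _ _ "max (Suc K) M"]) blast
qed

lemma bowen_pressure_prod_ge:
  assumes "NDS X T" "Z \<subseteq> mspace (X 0)" "equicont_seq X f"
    and defined: "sum_well_defined (bowen_pressure X T f Z) (bowen_pressure Y R g W)"
  shows "bowen_pressure X T f Z + bowen_pressure Y R g W
    \<le> bowen_pressure (prod_spaces X Y) (prod_maps T R) (dotplus f g) (Z \<times> W)"
    (is "?A + ?B \<le> ?P")
proof (rule ccontr)
  assume "\<not> ?A + ?B \<le> ?P"
  then have "?P < ?A + ?B"
    by simp
  with defined obtain a b u where ab: "ereal a < ?A" "ereal b < ?B" and u: "?P < ereal u" "u < a + b"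
    by (rule ereal_less_add_realE)
  \<comment> \<open>Half the gap, because \<open>bowen_measure_fst_eq_0\<close> raises the exponent
    by \<open>2 * \<delta>\<close>: from \<open>u - b\<close> it arrives exactly at
    \<open>a\<close>.\<close>
  define \<delta> where "\<delta> = (a + b - u) / 2"
  have "0 < \<delta>"
    using u by (simp add: \<delta>_def)
  obtain \<epsilon>1 where \<epsilon>1: "0 < \<epsilon>1" "ereal a < bowen_pressure_at X T f Z \<epsilon>1"
    using ab(1) by (auto simp: bowen_pressure_eq_SUP less_SUP_iff)
  obtain \<epsilon>2 where \<epsilon>2: "0 < \<epsilon>2" "ereal b < bowen_pressure_at Y R g W \<epsilon>2"
    using ab(2) by (auto simp: bowen_pressure_eq_SUP less_SUP_iff)
  obtain \<epsilon>3 where \<epsilon>3: "0 < \<epsilon>3"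
    "\<forall>k. \<forall>x\<in>mspace (X k). \<forall>y\<in>mspace (X k). mdist (X k) x y < \<epsilon>3 \<longrightarrow> \<bar>f k x - f k y\<bar> < \<delta>"
    using \<open>equicont_seq X f\<close> \<open>0 < \<delta>\<close> unfolding equicont_seq_def by blast
  \<comment> \<open>One radius for three demands: oscillation at most \<delta>, the pressure of
    \<open>W\<close> above \<open>b\<close>, and the pressure of \<open>Z\<close> above
    \<open>a\<close> even at the doubled radius.\<close>
  define \<epsilon> where "\<epsilon> = min (\<epsilon>1 / 2) (min \<epsilon>2 \<epsilon>3)"
  have \<epsilon>: "0 < \<epsilon>" "2 * \<epsilon> \<le> \<epsilon>1" "\<epsilon> \<le> \<epsilon>2" "\<epsilon> \<le> \<epsilon>3"
    using \<epsilon>1 \<epsilon>2 \<epsilon>3 by (auto simp: \<epsilon>_def)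
  \<comment> \<open>The exponent \<open>u\<close>, at which the product measure vanishes, is split
    into \<open>u - b\<close> for \<open>Z\<close> and \<open>b\<close> for \<open>W\<close>. As the
    measure of \<open>W\<close> at \<open>b\<close> is nonzero, that of \<open>Z\<close> must
    vanish, against the choice of \<open>a\<close>.\<close>
  have "bowen_measure X T f Z ((u - b) + 2 * \<delta>) (2 * \<epsilon>) = 0"
  proof (rule bowen_measure_fst_eq_0[OF assms(1,2) \<open>0 < \<epsilon>\<close> \<open>0 < \<delta>\<close>])
    show "\<forall>k. \<forall>x\<in>mspace (X k). \<forall>y\<in>mspace (X k). mdist (X k) x y < \<epsilon> \<longrightarrow> \<bar>f k x - f k y\<bar> \<le> \<delta>"
      using \<epsilon>3(2) \<epsilon>(4) by (meson less_imp_le less_le_trans)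
    have "bowen_pressure_at (prod_spaces X Y) (prod_maps T R) (dotplus f g) (Z \<times> W) \<epsilon> \<le> ?P"
      unfolding bowen_pressure_eq_SUP by (rule SUP_upper) (use \<epsilon> in simp)
    then show "bowen_measure (prod_spaces X Y) (prod_maps T R) (dotplus f g) (Z \<times> W) (u - b + b) \<epsilon> = 0"
      using u(1) by (intro bowen_measure_eq_0) simp
    have "ereal b < bowen_pressure_at Y R g W \<epsilon>"
      using \<epsilon>2(2) bowen_pressure_at_antimono[OF \<epsilon>(3)] by (rule less_le_trans)
    then show "bowen_measure Y R g W b \<epsilon> \<noteq> 0"
      using bowen_pressure_at_le[of Y R g W b \<epsilon>] by (auto simp: not_le[symmetric])
  qed
  moreover have "u - b + 2 * \<delta> = a"
    by (simp add: \<delta>_def field_simps)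
  ultimately have "bowen_pressure_at X T f Z (2 * \<epsilon>) \<le> ereal a"
    using bowen_pressure_at_le by metis
  moreover have "ereal a < bowen_pressure_at X T f Z (2 * \<epsilon>)"
    using \<epsilon>1(2) bowen_pressure_at_antimono[OF \<epsilon>(2)] by (rule less_le_trans)
  ultimately show False
    by simp
qed

theorem theorem6p1:
  fixes X :: "nat \<Rightarrow> 'a metric" and T :: "nat \<Rightarrow> 'a \<Rightarrow> 'a" and f :: "nat \<Rightarrow> 'a \<Rightarrow> real"
    and Y :: "nat \<Rightarrow> 'b metric" and R :: "nat \<Rightarrow> 'b \<Rightarrow> 'b" and g :: "nat \<Rightarrow> 'b \<Rightarrow> real"
    and Z :: "'a set" and W :: "'b set"
  assumes "NDS X T" and "NDS Y R"
    and "Z \<subseteq> mspace (X 0)" and "W \<subseteq> mspace (Y 0)"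
    and "cont_fun_seq X f" and "equicont_seq X f"
    and "cont_fun_seq Y g" and "equicont_seq Y g"
    and "sum_well_defined (bowen_pressure X T f Z) (bowen_pressure Y R g W)"
    and "sum_well_defined (bowen_pressure X T f Z) (packing_pressure Y R g W)"
  shows "bowen_pressure X T f Z + bowen_pressure Y R g W
           \<le> bowen_pressure (prod_spaces X Y) (prod_maps T R) (dotplus f g) (Z \<times> W)
       \<and> bowen_pressure (prod_spaces X Y) (prod_maps T R) (dotplus f g) (Z \<times> W)
           \<le> bowen_pressure X T f Z + packing_pressure Y R g W"
  using assms by (blast intro: bowen_pressure_prod_ge bowen_pressure_prod_le)

end
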